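(* Let $V$ be an elementary abelian $2$-group, let $n\ge 0$ be an integer, and let $E$ be an unstable $\mathrm{H}^{*}V$-$A$-module which is free as an $\mathrm{H}^{*}V$-module. If $\overline{E}=\mathbb{F}_2\otimes_{\mathrm{H}^{*}V}E$ is isomorphic (as an unstable $A$-module) to $\Sigma^{n}\mathbb{F}_2$, then there exist an element $u\in\mathrm{H}^{*}V$ and an integer $d\ge 0$ such that: (1) $u=\prod_i\theta_i^{\alpha_i}$ (a finite product), where $\theta_i\in \mathrm{H}^{1}V\setminus\{0\}$ and $\alpha_i\in\mathbb{N}$; (2) $E\cong\Sigma^{d}\,u\,\mathrm{H}^{*}V$ (as unstable $\mathrm{H}^{*}V$-$A$-modules), with $d+\sum_i\alpha_i=n$.
   Context: $A$ is the mod 2 Steenrod algebra; an unstable $A$-module is a graded $A$-module $M$ with $Sq^ix=0$ for $i>|x|$. $V$ is an elementary abelian $2$-group, i.e. a group isomorphic to $(\mathbb{Z}/2)^r$ for some $r\in\mathbb{N}$; $\mathrm{H}^{*}V=H^{*}(BV;\mathbb{F}_2)$ is a polynomial algebra over $\mathbb{F}_2$ on $r$ generators of degree one. An unstable $\mathrm{H}^{*}V$-$A$-module is an unstable $A$-module $E$ with a graded $\mathrm{H}^{*}V$-module structure whose action map $\mathrm{H}^{*}V\otimes E\to E$ is $A$-linear (with the diagonal, Cartan formula, action on the tensor product); morphisms are degree-zero maps that are both $\mathrm{H}^{*}V$-linear and $A$-linear. $\overline{E}=\mathbb{F}_2\otimes_{\mathrm{H}^{*}V}E=E/(\widetilde{\mathrm{H}^{*}}V\cdot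 E)$, where $\widetilde{\mathrm{H}^{*}}V$ is the augmentation ideal. $\Sigma^{d}$ denotes the $d$-fold suspension: $(\Sigma^{d}N)^{k}=N^{k-d}$, with $Sq^i\Sigma^{d}x=\Sigma^{d}Sq^ix$ and $h\cdot\Sigma^{d}x=\Sigma^{d}(hx)$ for $h\in\mathrm{H}^{*}V$; $\mathbb{F}_2$ is concentrated in degree $0$. $u\,\mathrm{H}^{*}V$ is the principal ideal of $\mathrm{H}^{*}V$ generated by $u$; for $u$ a product of degree-one classes it is stable under the Steenrod operations, hence a sub-$\mathrm{H}^{*}V$-$A$-module of $\mathrm{H}^{*}V$. *)

theory Defs
  imports "HOL-Algebra.Module" "HOL-Algebra.Ideal" "HOL-Algebra.Product_Groups"
    "HOL-Library.Poly_Mapping" "HOL-Library.Z2"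
begin

section \<open>Modules over the mod 2 Steenrod algebra\<close>

definition F2 :: "bit ring" where
  "F2 = \<lparr>carrier = UNIV, monoid.mult = (*), one = 1, ring.zero = 0, ring.add = (+)\<rparr>"

lemma cring_F2: "cring F2"
proof (rule cringI)
  show "abelian_group F2"
  proof (rule abelian_groupI)
    fix x assume "x \<in> carrier F2"
    then show "\<exists>y\<in>carrier F2. y \<oplus>\<^bsub>F2\<^esub> x = \<zero>\<^bsub>F2\<^esub>"
      by (intro bexI[of _ "- x"]) (simp_all only: F2_def ring_record_simps ab_left_minus UNIV_I)
  qed (simp_all add: F2_def ac_simps del: add_bit_eq_xor)
  show "comm_monoid F2"
    by (rule comm_monoidI) (simp_all add: F2_def ac_simps del: mult_bit_eq_and)
qed (simp add: F2_def distrib_right del: add_bit_eq_xor mult_bit_eq_and)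

text \<open>
  A graded module is represented by its total module (the direct sum of its homogeneous parts)
  together with the family \<open>gr\<close> of homogeneous parts; \<open>Sq i\<close> acts on the total module.  The
  fields \<open>mult\<close> and \<open>one\<close>, which \<^type>\<open>module\<close> inherits from rings, play no role.
\<close>

record ('r, 'a) sq_module = "('r, 'a) module" +
  gr :: "int \<Rightarrow> 'a set"
  Sq :: "nat \<Rightarrow> 'a \<Rightarrow> 'a"

text \<open>
  The Steenrod algebra is the \<open>\<F>\<^sub>2\<close>-algebra generated by the \<open>Sq\<^sup>i\<close> subject to \<open>Sq\<^sup>0 = 1\<close> and the
  Adem relations, so that a module over it is a vector space with operators \<open>Sq\<^sup>i\<close> satisfying
  these relations.
\<close>

locale unstable_A_module = module F2 M for M :: "(bit, 'a) sq_module" (structure) +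
  assumes gr_submodule: "submodule (gr M k) F2 M"
    and gr_direct_sum: "x \<in> carrier M \<Longrightarrow>
      \<exists>!f. (\<forall>k. f k \<in> gr M k) \<and> finite {k. f k \<noteq> \<zero>\<^bsub>M\<^esub>} \<and>
           x = (\<Oplus>\<^bsub>M\<^esub> k \<in> {k. f k \<noteq> \<zero>\<^bsub>M\<^esub>}. f k)"
    and Sq_add: "x \<in> carrier M \<Longrightarrow> y \<in> carrier M \<Longrightarrow> Sq M i (x \<oplus>\<^bsub>M\<^esub> y) = Sq M i x \<oplus>\<^bsub>M\<^esub> Sq M i y"
    and Sq_gr: "x \<in> gr M k \<Longrightarrow> Sq M i x \<in> gr M (k + int i)"
    and Sq_0: "x \<in> carrier M \<Longrightarrow> Sq M 0 x = x"
    and Adem: "x \<in> carrier M \<Longrightarrow> 0 < a \<Longrightarrow> a < 2 * b \<Longrightarrow>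
      Sq M a (Sq M b x) =
        (\<Oplus>\<^bsub>M\<^esub> c \<in> {..a div 2}.
           of_nat ((b - 1 - c) choose (a - 2 * c)) \<odot>\<^bsub>M\<^esub> Sq M (a + b - c) (Sq M c x))"
    and unstable: "x \<in> gr M k \<Longrightarrow> k < int i \<Longrightarrow> Sq M i x = \<zero>\<^bsub>M\<^esub>"

definition sq_iso ::
    "('r, 's) ring_scheme \<Rightarrow> ('r, 'a) sq_module \<Rightarrow> ('r, 'b) sq_module \<Rightarrow> bool" where
  "sq_iso R M N \<longleftrightarrow> (\<exists>\<phi>.
     bij_betw \<phi> (carrier M) (carrier N) \<and>
     (\<forall>x\<in>carrier M. \<forall>y\<in>carrier M. \<phi> (x \<oplus>\<^bsub>M\<^esub> y) = \<phi> x \<oplus>\<^bsub>N\<^esub> \<phi> y) \<and>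
     (\<forall>c\<in>carrier R. \<forall>x\<in>carrier M. \<phi> (c \<odot>\<^bsub>M\<^esub> x) = c \<odot>\<^bsub>N\<^esub> \<phi> x) \<and>
     (\<forall>k. \<forall>x\<in>gr M k. \<phi> x \<in> gr N k) \<and>
     (\<forall>i. \<forall>x\<in>carrier M. \<phi> (Sq M i x) = Sq N i (\<phi> x)))"

definition suspension :: "nat \<Rightarrow> ('r, 'a) sq_module \<Rightarrow> ('r, 'a) sq_module" where
  "suspension d M = M\<lparr>gr := \<lambda>k. gr M (k - int d)\<rparr>"

definition F2_module :: "(bit, bit) sq_module" where
  "F2_module = \<lparr>carrier = UNIV, monoid.mult = (*), one = 1, ring.zero = 0, ring.add = (+), smult = (*),
     gr = (\<lambda>k. if k = 0 then UNIV else {0}),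
     Sq = (\<lambda>i x. if i = 0 then x else 0)\<rparr>"

definition quotient_module :: "('r, 'a) sq_module \<Rightarrow> 'a set \<Rightarrow> ('r, 'a set) sq_module" where
  "quotient_module M N = \<lparr>carrier = a_rcosets\<^bsub>M\<^esub> N, monoid.mult = undefined, one = undefined,
     ring.zero = N, ring.add = set_add M,
     smult = (\<lambda>c C. \<Union>x\<in>C. N +>\<^bsub>M\<^esub> (c \<odot>\<^bsub>M\<^esub> x)),
     gr = (\<lambda>k. (\<lambda>x. N +>\<^bsub>M\<^esub> x) ` gr M k),
     Sq = (\<lambda>i C. \<Union>x\<in>C. N +>\<^bsub>M\<^esub> Sq M i x)\<rparr>"


section \<open>The cohomology of an elementary abelian 2-group\<close>

abbreviation Z2_power :: "nat \<Rightarrow> (nat \<Rightarrow> int) monoid" where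
  "Z2_power r \<equiv> product_group {..<r} (\<lambda>_. integer_mod_group 2)"

definition elementary_abelian_2_group :: "('g, 'm) monoid_scheme \<Rightarrow> bool" where
  "elementary_abelian_2_group V \<longleftrightarrow> group V \<and> (\<exists>r. V \<cong> Z2_power r)"

definition rank :: "('g, 'm) monoid_scheme \<Rightarrow> nat" where
  "rank V = (THE r. V \<cong> Z2_power r)"

lemma rank_eq: "V \<cong> Z2_power r \<Longrightarrow> rank V = r"
proof -
  have card: "order V = 2 ^ s" if "V \<cong> Z2_power s" for s
    using iso_same_card[OF that]
    by (simp add: order_def card_PiE carrier_integer_mod_group)
  assume r: "V \<cong> Z2_power r"
  show ?thesis
    unfolding rank_def
  proof (rule the_equality[of "\<lambda>s. V \<cong> Z2_power s", OF r])
    fix s assume "V \<cong> Z2_power s"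
    then have "(2::nat) ^ s = 2 ^ r" using card[of s] card[OF r] by metis
    then show "s = r" by simp
  qed
qed

text \<open>
  \<open>H\<^sup>*V\<close> is modelled as \<open>\<F>\<^sub>2[x\<^sub>0, \<dots>, x\<^bsub>r-1\<^esub>]\<close> with \<open>r\<close> the rank of \<open>V\<close>.  A monomial is its
  exponent vector, and a polynomial is the finitely supported function of its coefficients.
\<close>

type_synonym monom = "nat \<Rightarrow>\<^sub>0 nat"
type_synonym poly2 = "monom \<Rightarrow>\<^sub>0 bit"

definition Hstar :: "('g, 'm) monoid_scheme \<Rightarrow> poly2 ring" where
  "Hstar V = \<lparr>carrier = {p. \<forall>m\<in>Poly_Mapping.keys p. Poly_Mapping.keys m \<subseteq> {..<rank V}},
     monoid.mult = (*), one = 1, ring.zero = 0, ring.add = (+)\<rparr>"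

lemma cring_Hstar: "cring (Hstar V)"
proof -
  let ?C = "carrier (Hstar V)"
  have add: "p + q \<in> ?C" if "p \<in> ?C" "q \<in> ?C" for p q
    using that Poly_Mapping.keys_add[of p q] unfolding Hstar_def partial_object.simps by blast
  have uminus: "- p \<in> ?C" if "p \<in> ?C" for p
    using that by (simp add: Hstar_def)
  have mult: "p * q \<in> ?C" if p: "p \<in> ?C" and q: "q \<in> ?C" for p q
  proof -
    have "Poly_Mapping.keys m \<subseteq> {..<rank V}" if m: "m \<in> Poly_Mapping.keys (p * q)" for m
    proof -
      obtain a b where ab: "m = a + b" "a \<in> Poly_Mapping.keys p" "b \<in> Poly_Mapping.keys q"
        using keys_mult[of p q] m by blast
      have "Poly_Mapping.keys m \<subseteq> Poly_Mapping.keys a \<union> Poly_Mapping.keys b"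
        unfolding ab(1) by (rule Poly_Mapping.keys_add)
      moreover have "Poly_Mapping.keys a \<subseteq> {..<rank V}" "Poly_Mapping.keys b \<subseteq> {..<rank V}"
        using p q ab unfolding Hstar_def by simp_all
      ultimately show ?thesis by blast
    qed
    then show ?thesis by (simp add: Hstar_def)
  qed
  have ops: "x \<oplus>\<^bsub>Hstar V\<^esub> y = x + y" "x \<otimes>\<^bsub>Hstar V\<^esub> y = x * y"
    "\<zero>\<^bsub>Hstar V\<^esub> = 0" "\<one>\<^bsub>Hstar V\<^esub> = 1" for x y
    by (simp_all add: Hstar_def)
  have units: "0 \<in> ?C" "1 \<in> ?C"
    by (simp_all add: Hstar_def)
  show ?thesis
  proof (rule cringI)
    show "abelian_group (Hstar V)"
      by (rule abelian_groupI)
        (auto simp: ops units add add.assoc add.commute intro: bexI[OF _ uminus])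
    show "Group.comm_monoid (Hstar V)"
      by (rule comm_monoidI) (simp_all add: ops units mult mult.assoc mult.commute)
  qed (simp add: ops distrib_right)
qed

definition mdeg :: "monom \<Rightarrow> nat" where
  "mdeg m = (\<Sum>i\<in>Poly_Mapping.keys m. poly_mapping.lookup m i)"

definition Hstar_gr :: "('g, 'm) monoid_scheme \<Rightarrow> int \<Rightarrow> poly2 set" where
  "Hstar_gr V k = {p \<in> carrier (Hstar V). \<forall>m\<in>Poly_Mapping.keys p. int (mdeg m) = k}"

definition homogeneous_part :: "nat \<Rightarrow> poly2 \<Rightarrow> poly2" where
  "homogeneous_part k p =
     (\<Sum>m | m \<in> Poly_Mapping.keys p \<and> mdeg m = k.
        Poly_Mapping.single m (poly_mapping.lookup p m))"

definition var :: "nat \<Rightarrow> poly2" where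
  "var i = Poly_Mapping.single (Poly_Mapping.single i 1) 1"

text \<open>
  On \<open>H\<^sup>*V\<close> the total square \<open>Sq = \<Sum>\<^sub>i Sq\<^sup>i\<close> is multiplicative (Cartan formula) and
  satisfies \<open>Sq x = x + x\<^sup>2\<close> for \<open>x\<close> of degree one.  Hence \<open>Sq\<^sup>i\<close> of a monomial of degree \<open>k\<close> is the
  part of degree \<open>k + i\<close> of its total square.
\<close>

definition total_square :: "monom \<Rightarrow> poly2" where
  "total_square m = (\<Prod>i\<in>Poly_Mapping.keys m. (var i + var i ^ 2) ^ poly_mapping.lookup m i)"

definition Hstar_Sq :: "nat \<Rightarrow> poly2 \<Rightarrow> poly2" where
  "Hstar_Sq i p = (\<Sum>m\<in>Poly_Mapping.keys p. homogeneous_part (mdeg m + i) (total_square m))"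

definition augmentation_ideal :: "('g, 'm) monoid_scheme \<Rightarrow> poly2 set" where
  "augmentation_ideal V = {h \<in> carrier (Hstar V). poly_mapping.lookup h 0 = 0}"


section \<open>Unstable \<open>H\<^sup>*V\<close>-\<open>A\<close>-modules\<close>

text \<open>Restriction of scalars along the unit \<open>\<F>\<^sub>2 \<rightarrow> H\<^sup>*V\<close>.\<close>

definition underlying_A_module :: "(poly2, 'a) sq_module \<Rightarrow> (bit, 'a) sq_module" where
  "underlying_A_module E = \<lparr>carrier = carrier E, monoid.mult = monoid.mult E, one = one E,
     ring.zero = ring.zero E, ring.add = ring.add E,
     smult = (\<lambda>c x. Poly_Mapping.single 0 c \<odot>\<^bsub>E\<^esub> x),
     gr = gr E, Sq = Sq E\<rparr>"

text \<open>The last axiom says that the action map \<open>H\<^sup>*V \<otimes> E \<rightarrow> E\<close> is \<open>A\<close>-linear.\<close>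

locale unstable_HV_A_module =
  fixes V :: "('g, 'm) monoid_scheme" and E :: "(poly2, 'a) sq_module"
  assumes Hstar_module: "module (Hstar V) E"
    and A_module: "unstable_A_module (underlying_A_module E)"
    and smult_gr: "h \<in> Hstar_gr V j \<Longrightarrow> x \<in> gr E k \<Longrightarrow> h \<odot>\<^bsub>E\<^esub> x \<in> gr E (j + k)"
    and Cartan: "h \<in> carrier (Hstar V) \<Longrightarrow> x \<in> carrier E \<Longrightarrow>
      Sq E i (h \<odot>\<^bsub>E\<^esub> x) = (\<Oplus>\<^bsub>E\<^esub> j \<in> {..i}. Hstar_Sq j h \<odot>\<^bsub>E\<^esub> Sq E (i - j) x)"

definition free_module :: "('r, 's) ring_scheme \<Rightarrow> ('r, 'a, 't) module_scheme \<Rightarrow> bool" where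
  "free_module R M \<longleftrightarrow> (\<exists>B \<subseteq> carrier M. \<forall>x\<in>carrier M.
     \<exists>!c. (\<forall>b\<in>B. c b \<in> carrier R) \<and> (\<forall>b. b \<notin> B \<longrightarrow> c b = \<zero>\<^bsub>R\<^esub>) \<and>
          finite {b. c b \<noteq> \<zero>\<^bsub>R\<^esub>} \<and>
          x = (\<Oplus>\<^bsub>M\<^esub> b \<in> {b. c b \<noteq> \<zero>\<^bsub>R\<^esub>}. c b \<odot>\<^bsub>M\<^esub> b))"

definition reduction ::
    "('g, 'm) monoid_scheme \<Rightarrow> (poly2, 'a) sq_module \<Rightarrow> (bit, 'a set) sq_module" where
  "reduction V E = quotient_module (underlying_A_module E)
     (generate (add_monoid E)
        {h \<odot>\<^bsub>E\<^esub> x | h x. h \<in> augmentation_ideal V \<and> x \<in> carrier E})"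

definition principal_ideal_module ::
    "('g, 'm) monoid_scheme \<Rightarrow> poly2 \<Rightarrow> (poly2, poly2) sq_module" where
  "principal_ideal_module V u = \<lparr>carrier = PIdl\<^bsub>Hstar V\<^esub> u, monoid.mult = (*), one = 1,
     ring.zero = 0, ring.add = (+), smult = (*),
     gr = (\<lambda>k. PIdl\<^bsub>Hstar V\<^esub> u \<inter> Hstar_gr V k), Sq = Hstar_Sq\<rparr>"

end

theory Submission
  imports Defs
begin

text \<open>
  Since \<open>E\<close> is free over \<open>H\<^sup>*V\<close> with one-dimensional reduction, the graded Nakayama lemma gives
  \<open>E = H\<^sup>*V e\<close> with \<open>|e| = n\<close>, and \<open>Sq\<^sup>i e = w\<^sub>i e\<close>.  Let \<open>m\<close> be the largest index with \<open>w\<^sub>m \<noteq> 0\<close>, and put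
  \<open>u = w\<^sub>m\<close> and \<open>w = \<Sum>\<^sub>i w\<^sub>i\<close>.  The Adem relations for \<open>Sq\<^sup>a Sq\<^sup>m e\<close> collapse to \<open>Sq(u) w = w\<^sup>2 u\<close>, where \<open>Sq\<close> is
  the total square, so \<open>Sq(u) = w u\<close>, and \<open>h e \<mapsto> h u\<close> identifies \<open>E\<close> with the \<open>(n - m)\<close>-fold suspension of
  the ideal \<open>(u)\<close>.

  It remains to see that a nonzero homogeneous \<open>u\<close> dividing \<open>Sq(u)\<close> is a product of linear forms, by
  induction on the degree.  The derivations \<open>D\<^sub>j = \<Sum>\<^sub>i x\<^sub>i^(2^j) \<partial>\<^sub>i\<close> satisfy \<open>Sq D\<^sub>j = (D\<^sub>j + D\<^bsub>j+1\<^esub>) Sq\<close>,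
  and \<open>D\<^sub>0 u\<close> is a multiple of \<open>u\<close> by Euler's identity, so \<open>u\<close> divides every \<open>D\<^sub>j u\<close>.  Hence \<open>u\<close> divides
  \<open>\<Sum>\<^sub>i f(x\<^sub>i) \<partial>\<^sub>i u\<close> for every additive polynomial \<open>f\<close>.  Taking for \<open>f(X)\<close> the product of all \<open>X + \<theta>\<close> with
  \<open>\<theta>\<close> in the span of the variables other than \<open>x\<^sub>i\<close>, only \<open>f(x\<^sub>i) \<partial>\<^sub>i u\<close> survives, where \<open>f(x\<^sub>i)\<close> is a product of
  linear forms.  If no linear form divides \<open>u\<close>, these prime factors cancel, and for degree reasons all
  \<open>\<partial>\<^sub>i u\<close> vanish.  Then \<open>u\<close> and \<open>w\<close> are squares and the induction hypothesis applies to the square root of \<open>u\<close>.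
\<close>

section \<open>Polynomials over the field with two elements\<close>

abbreviation keys where "keys \<equiv> Poly_Mapping.keys"
abbreviation lookup where "lookup \<equiv> poly_mapping.lookup"
abbreviation mon :: "monom \<Rightarrow> poly2" where "mon m \<equiv> Poly_Mapping.single m 1"
abbreviation unit_monom :: "nat \<Rightarrow> monom" where "unit_monom i \<equiv> Poly_Mapping.single i 1"

section \<open>Characteristic two and linear extension from monomials\<close>

lemma poly2_two [simp]: "(2::poly2) = 0"
  by (metis bit_2_eq_0 single_numeral single_zero)

lemma poly2_double [simp]: "p + p = (0::poly2)"
  by (simp flip: mult_2)

lemma poly2_double_left [simp]: "p + (p + q) = (q::poly2)"
  by (simp flip: add.assoc)

lemma poly2_eq_iff_add: "p = q \<longleftrightarrow> p + q = (0::poly2)"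
  by (metis add_left_cancel poly2_double)

lemma poly2_uminus [simp]: "- p = (p::poly2)"
  using poly2_double[of p] by (metis add_eq_0_iff)

lemma poly2_minus [simp]: "p - q = p + (q::poly2)"
  using diff_conv_add_uminus[of p q] by simp

lemma poly2_square_add: "(p + q)\<^sup>2 = p\<^sup>2 + (q::poly2)\<^sup>2"
proof -
  have "(p + q)\<^sup>2 = p\<^sup>2 + q\<^sup>2 + (p * q + p * q)" by (simp add: power2_eq_square algebra_simps del: poly2_double)
  then show ?thesis by simp
qed

lemma poly2_power2_power_add: "(p + q) ^ 2 ^ n = p ^ 2 ^ n + (q::poly2) ^ 2 ^ n"
  by (induction n) (simp_all add: power_mult poly2_square_add mult.commute[of 2])

lemma poly2_square_inj: "p\<^sup>2 = q\<^sup>2 \<Longrightarrow> p = (q::poly2)"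
  by (metis poly2_eq_iff_add poly2_square_add power_not_zero)

text \<open>Coefficients are bits, so a polynomial amounts to its finite set \<open>keys p\<close>
  of monomials, and linear extension of \<open>F\<close> needs no scalars. A monomial common to two
  summands cancels, which keeps the extension additive.\<close>

definition mon_sum :: "(monom \<Rightarrow> poly2) \<Rightarrow> poly2 \<Rightarrow> poly2" where
  "mon_sum F p = (\<Sum>m\<in>keys p. F m)"

lemma mon_sum_superset:
  assumes "finite A" "keys p \<subseteq> A"
  shows "mon_sum F p = (\<Sum>m\<in>A. if lookup p m = 0 then 0 else F m)"
  unfolding mon_sum_def
  by (rule sum.mono_neutral_cong_left) (use assms in \<open>auto simp: in_keys_iff\<close>)

lemma mon_sum_add: "mon_sum F (p + q) = mon_sum F p + mon_sum F q"
proof -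
  let ?A = "keys p \<union> keys q"
  have A: "finite ?A" "keys (p + q) \<subseteq> ?A" "keys p \<subseteq> ?A" "keys q \<subseteq> ?A"
    using Poly_Mapping.keys_add[of p q] by auto
  show ?thesis
    unfolding mon_sum_superset[OF A(1,2)] mon_sum_superset[OF A(1,3)] mon_sum_superset[OF A(1,4)]
      sum.distrib[symmetric]
  proof (rule sum.cong[OF refl])
    fix m
    show "(if lookup (p + q) m = 0 then 0 else F m) =
      (if lookup p m = 0 then 0 else F m) + (if lookup q m = 0 then 0 else F m)"
      by (cases "lookup p m"; cases "lookup q m") (simp_all add: lookup_add)
  qed
qed

lemma mon_sum_0 [simp]: "mon_sum F 0 = 0"
  by (simp add: mon_sum_def)

lemma mon_sum_mon [simp]: "mon_sum F (mon m) = F m"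
  by (simp add: mon_sum_def)

lemma mon_sum_sum: "mon_sum F (sum f A) = (\<Sum>a\<in>A. mon_sum F (f a))"
  by (induction A rule: infinite_finite_induct) (simp_all add: mon_sum_add)

lemma poly2_sum_mon: "p = (\<Sum>m\<in>keys p. mon m)"
proof (rule poly_mapping_eqI)
  fix k
  have "lookup (\<Sum>m\<in>keys p. mon m) k = (\<Sum>m\<in>keys p. if m = k then 1 else 0)"
    unfolding lookup_sum by (rule sum.cong) (auto simp: lookup_single when_def)
  also have "\<dots> = (if k \<in> keys p then 1 else 0)" by simp
  finally show "lookup p k = lookup (\<Sum>m\<in>keys p. mon m) k"
    by (cases "lookup p k = 0") (simp_all add: in_keys_iff)
qed

lemma mon_sum_mon_id [simp]: "mon_sum mon p = p"
  using poly2_sum_mon by (simp add: mon_sum_def)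

lemma poly2_induct [case_names zero mon add]:
  assumes "P 0" "\<And>m. P (mon m)" "\<And>p q. P p \<Longrightarrow> P q \<Longrightarrow> P (p + q)"
  shows "P (p :: poly2)"
proof -
  have "P (\<Sum>m\<in>A. mon m)" if "finite A" for A
    using that by induction (use assms in auto)
  then show ?thesis using poly2_sum_mon[of p] by (metis finite_keys)
qed

text \<open>Confining the keys to \<open>A\<close> makes homogeneity, or a bound on the variables,
  available for both summands in the additive step.\<close>

lemma poly2_set_induct [consumes 1, case_names zero mon add]:
  assumes "keys p \<subseteq> A" "P 0" "\<And>m. m \<in> A \<Longrightarrow> P (mon m)"
    "\<And>p q. keys p \<subseteq> A \<Longrightarrow> keys q \<subseteq> A \<Longrightarrow> P p \<Longrightarrow> P q \<Longrightarrow> P (p + q)"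
  shows "P (p :: poly2)"
proof -
  have "P (\<Sum>m\<in>B. mon m) \<and> keys (\<Sum>m\<in>B. mon m) \<subseteq> A" if "finite B" "B \<subseteq> A" for B
    using that
  proof induction
    case (insert m B)
    then have "keys (mon m + (\<Sum>m\<in>B. mon m)) \<subseteq> A"
      using Poly_Mapping.keys_add[of "mon m" "\<Sum>m\<in>B. mon m"] by auto
    with insert show ?case by (auto intro!: assms(4) assms(3))
  qed (use assms in auto)
  then show ?thesis using poly2_sum_mon[of p] assms(1) by (metis finite_keys)
qed

lemma mon_mult: "mon a * mon b = mon (a + b)"
  by (simp add: mult_single)

lemma mon_power: "mon a ^ 2 = mon (a + a)"
  by (simp add: power2_eq_square mon_mult)

lemma mon_sum_mult:
  assumes F: "\<And>a b. F (a + b) = F a * F b"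
  shows "mon_sum F (p * q) = mon_sum F p * mon_sum F q"
proof (induction p rule: poly2_induct)
  case (mon m)
  show ?case
    by (induction q rule: poly2_induct) (simp_all add: mon_mult F distrib_left mon_sum_add)
qed (simp_all add: distrib_right mon_sum_add)

lemma monom_induct [case_names zero add]:
  assumes "P 0" "\<And>m i. P m \<Longrightarrow> P (m + unit_monom i)"
  shows "P (m :: monom)"
proof (induction "\<Sum>i\<in>keys m. lookup m i" arbitrary: m rule: less_induct)
  case less
  show ?case
  proof (cases "m = 0")
    case False
    then obtain i where i: "i \<in> keys m" by (metis keys_eq_empty equals0I)
    define m' where "m' = m - unit_monom i"
    have m: "m = m' + unit_monom i"
      using i by (intro poly_mapping_eqI) (auto simp: m'_def lookup_add lookup_minus lookup_single when_def in_keys_iff)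
    have "keys m' \<subseteq> keys m" using i by (auto simp: m in_keys_iff lookup_add)
    then have "(\<Sum>i\<in>keys m'. lookup m' i) = (\<Sum>i\<in>keys m. lookup m' i)"
      by (intro sum.mono_neutral_left) (auto simp: in_keys_iff)
    also have "\<dots> < (\<Sum>i\<in>keys m. lookup m i)"
      by (rule sum_strict_mono_ex1)
        (use i in \<open>auto simp: m lookup_add intro!: bexI[of _ i]\<close>)
    finally show ?thesis using less assms(2) m by metis
  qed (use assms in auto)
qed

lemma poly2_alg_induct [case_names zero one add mult]:
  assumes "P 0" "P 1" "\<And>p q. P p \<Longrightarrow> P q \<Longrightarrow> P (p + q)" "\<And>p i. P p \<Longrightarrow> P (p * var i)"
  shows "P (p :: poly2)"
proof (induction p rule: poly2_induct)
  case (mon m)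
  show ?case
  proof (induction m rule: monom_induct)
    case (add m i)
    then have "P (mon m * var i)" by (rule assms)
    then show ?case by (simp add: var_def mon_mult)
  qed (use assms in simp)
qed (use assms in auto)

section \<open>Substitution homomorphisms and restriction to finitely many variables\<close>

definition subst :: "(nat \<Rightarrow> poly2) \<Rightarrow> poly2 \<Rightarrow> poly2" where
  "subst s = mon_sum (\<lambda>m. \<Prod>i\<in>keys m. s i ^ lookup m i)"

lemma monom_eval_superset:
  fixes s :: "nat \<Rightarrow> poly2"
  assumes "finite A" "keys m \<subseteq> A"
  shows "(\<Prod>i\<in>keys m. s i ^ lookup m i) = (\<Prod>i\<in>A. s i ^ lookup m i)"
  by (rule prod.mono_neutral_left) (use assms in \<open>auto simp: in_keys_iff\<close>)

lemma monom_eval_add: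
  fixes s :: "nat \<Rightarrow> poly2"
  shows "(\<Prod>i\<in>keys (a + b). s i ^ lookup (a + b) i) =
    (\<Prod>i\<in>keys a. s i ^ lookup a i) * (\<Prod>i\<in>keys b. s i ^ lookup b i)"
proof -
  let ?A = "keys a \<union> keys b"
  have A: "finite ?A" "keys (a + b) \<subseteq> ?A" "keys a \<subseteq> ?A" "keys b \<subseteq> ?A"
    using Poly_Mapping.keys_add[of a b] by auto
  show ?thesis
    unfolding monom_eval_superset[OF A(1,2)] monom_eval_superset[OF A(1,3)]
      monom_eval_superset[OF A(1,4)] prod.distrib[symmetric]
    by (simp add: lookup_add power_add)
qed

lemma subst_add: "subst s (p + q) = subst s p + subst s q"
  by (simp add: subst_def mon_sum_add)

lemma subst_mult: "subst s (p * q) = subst s p * subst s q"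
  unfolding subst_def by (rule mon_sum_mult) (rule monom_eval_add)

lemma subst_0 [simp]: "subst s 0 = 0"
  by (simp add: subst_def)

lemma subst_1 [simp]: "subst s 1 = 1"
  using mon_sum_mon[of _ 0] by (simp add: subst_def)

lemma subst_var [simp]: "subst s (var i) = s i"
  by (simp add: subst_def var_def)

lemma subst_power: "subst s (p ^ k) = subst s p ^ k"
  by (induction k) (simp_all add: subst_mult)

definition Pol :: "nat \<Rightarrow> poly2 set" where
  "Pol r = {p. \<forall>m\<in>keys p. keys m \<subseteq> {..<r}}"

lemma Pol_0 [simp]: "0 \<in> Pol r" by (simp add: Pol_def)
lemma Pol_1 [simp]: "1 \<in> Pol r" by (simp add: Pol_def)

lemma Pol_add: "p \<in> Pol r \<Longrightarrow> q \<in> Pol r \<Longrightarrow> p + q \<in> Pol r"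
  using Poly_Mapping.keys_add[of p q] by (auto simp: Pol_def)

lemma Pol_mult:
  assumes "p \<in> Pol r" "q \<in> Pol r" shows "p * q \<in> Pol r"
proof -
  have "keys m \<subseteq> {..<r}" if "m \<in> keys (p * q)" for m
  proof -
    obtain a b where "m = a + b" "a \<in> keys p" "b \<in> keys q"
      using keys_mult[of p q] \<open>m \<in> keys (p * q)\<close> by blast
    then show ?thesis using assms Poly_Mapping.keys_add[of a b] unfolding Pol_def by blast
  qed
  then show ?thesis by (simp add: Pol_def)
qed

lemma Pol_sum: "(\<And>a. a \<in> A \<Longrightarrow> f a \<in> Pol r) \<Longrightarrow> sum f A \<in> Pol r"
  by (induction A rule: infinite_finite_induct) (simp_all add: Pol_add)

lemma Pol_prod: "(\<And>a. a \<in> A \<Longrightarrow> f a \<in> Pol r) \<Longrightarrow> prod f A \<in> Pol r"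
  by (induction A rule: infinite_finite_induct) (simp_all add: Pol_mult)

lemma Pol_power: "p \<in> Pol r \<Longrightarrow> p ^ k \<in> Pol r"
  by (induction k) (simp_all add: Pol_mult)

lemma Pol_var: "i < r \<Longrightarrow> var i \<in> Pol r"
  by (simp add: Pol_def var_def)

lemma subst_Pol:
  assumes "p \<in> Pol r" "\<And>i. i < r \<Longrightarrow> s i \<in> Pol r"
  shows "subst s p \<in> Pol r"
  unfolding subst_def mon_sum_def using assms
  by (intro Pol_sum Pol_prod Pol_power assms) (auto simp: Pol_def)

lemma subst_id_on_Pol:
  assumes "p \<in> Pol r" "\<And>i. i < r \<Longrightarrow> s i = var i"
  shows "subst s p = p"
proof -
  have id: "subst var q = q" for q
    by (induction q rule: poly2_alg_induct) (simp_all add: subst_add subst_mult)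
  have "subst s p = subst var p"
    unfolding subst_def mon_sum_def
    by (intro sum.cong prod.cong refl) (use assms in \<open>auto simp: Pol_def subset_iff\<close>)
  then show ?thesis using id by simp
qed

text \<open>A retraction of the polynomial ring in infinitely many variables onto
  \<open>Pol r\<close>. It serves because \<open>dvd\<close> refers to the big ring, where a
  quotient could a priori involve further variables.\<close>

definition restrict_vars :: "nat \<Rightarrow> poly2 \<Rightarrow> poly2" where
  "restrict_vars r = subst (\<lambda>i. if i < r then var i else 0)"

lemma restrict_vars_Pol: "restrict_vars r p \<in> Pol r"
proof (induction p rule: poly2_alg_induct)
  case (mult p i)
  then show ?case by (simp add: restrict_vars_def subst_mult Pol_mult Pol_var)
qed (simp_all add: restrict_vars_def subst_add Pol_add)

lemma restrict_vars_id: "p \<in> Pol r \<Longrightarrow> restrict_vars r p = p"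
  unfolding restrict_vars_def by (rule subst_id_on_Pol) auto

section \<open>Degree and homogeneous parts\<close>

lemma mdeg_superset: "finite A \<Longrightarrow> keys m \<subseteq> A \<Longrightarrow> mdeg m = (\<Sum>i\<in>A. lookup m i)"
  unfolding mdeg_def by (rule sum.mono_neutral_left) (auto simp: in_keys_iff)

lemma mdeg_add [simp]: "mdeg (a + b) = mdeg a + mdeg b"
proof -
  let ?A = "keys a \<union> keys b"
  have A: "finite ?A" "keys (a + b) \<subseteq> ?A" "keys a \<subseteq> ?A" "keys b \<subseteq> ?A"
    using Poly_Mapping.keys_add[of a b] by auto
  show ?thesis
    unfolding mdeg_superset[OF A(1,2)] mdeg_superset[OF A(1,3)] mdeg_superset[OF A(1,4)]
    by (simp add: lookup_add sum.distrib)
qed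

lemma mdeg_0 [simp]: "mdeg 0 = 0" by (simp add: mdeg_def)

lemma mdeg_unit_monom [simp]: "mdeg (Poly_Mapping.single i (Suc 0)) = 1" by (simp add: mdeg_def)

lemma mdeg_eq_0_iff: "mdeg m = 0 \<longleftrightarrow> m = 0"
proof
  assume "mdeg m = 0"
  then have "\<forall>i\<in>keys m. lookup m i = 0" by (simp add: mdeg_def)
  then show "m = 0" by (intro poly_mapping_eqI) (auto simp: in_keys_iff)
qed simp

abbreviation hpart :: "nat \<Rightarrow> poly2 \<Rightarrow> poly2" where "hpart \<equiv> homogeneous_part"

lemma hpart_eq_mon_sum: "hpart k = mon_sum (\<lambda>m. if mdeg m = k then mon m else 0)"
proof
  fix p
  show "hpart k p = mon_sum (\<lambda>m. if mdeg m = k then mon m else 0) p"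
    unfolding homogeneous_part_def mon_sum_def
    by (rule sum.mono_neutral_cong_left) (auto simp: in_keys_iff)
qed

lemma hpart_add: "hpart k (p + q) = hpart k p + hpart k q"
  by (simp add: hpart_eq_mon_sum mon_sum_add)

lemma hpart_0 [simp]: "hpart k 0 = 0"
  by (simp add: hpart_eq_mon_sum)

lemma hpart_mon: "hpart k (mon m) = (if mdeg m = k then mon m else 0)"
  by (simp add: hpart_eq_mon_sum)

lemma hpart_sum: "hpart k (sum f A) = (\<Sum>a\<in>A. hpart k (f a))"
  by (simp add: hpart_eq_mon_sum mon_sum_sum)

lemma hpart_mult: "hpart k (p * q) = (\<Sum>j\<le>k. hpart j p * hpart (k - j) q)"
proof (induction p rule: poly2_induct)
  case (mon a)
  show ?case
  proof (induction q rule: poly2_induct)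
    case (mon b)
    have "(\<Sum>j\<le>k. hpart j (mon a) * hpart (k - j) (mon b)) =
      (\<Sum>j\<le>k. if mdeg a = j then (if mdeg a + mdeg b = k then mon (a + b) else 0) else 0)"
      by (rule sum.cong) (auto simp: hpart_mon mon_mult)
    also have "\<dots> = hpart k (mon a * mon b)"
      by (auto simp: hpart_mon mon_mult)
    finally show ?case by simp
  qed (simp_all add: distrib_left hpart_add sum.distrib)
qed (simp_all add: distrib_right hpart_add sum.distrib)

definition homog :: "nat \<Rightarrow> poly2 \<Rightarrow> bool" where
  "homog k p \<longleftrightarrow> (\<forall>m\<in>keys p. mdeg m = k)"

lemma homog_0 [simp]: "homog k 0" by (simp add: homog_def)

lemma homog_add: "homog k p \<Longrightarrow> homog k q \<Longrightarrow> homog k (p + q)"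
  using Poly_Mapping.keys_add[of p q] by (auto simp: homog_def)

lemma homog_mon [simp]: "homog k (mon m) \<longleftrightarrow> mdeg m = k" by (simp add: homog_def)

lemma homog_var [simp]: "homog (Suc 0) (var i)" by (simp add: var_def)

lemma homog_1 [simp]: "homog 0 1" by (simp add: homog_def)

lemma homog_mult: "homog k p \<Longrightarrow> homog l q \<Longrightarrow> homog (k + l) (p * q)"
  using keys_mult[of p q] by (fastforce simp: homog_def)

lemma hpart_homog: "homog k p \<Longrightarrow> hpart l p = (if l = k then p else 0)"
proof -
  assume "homog k p"
  then have "keys p \<subseteq> {m. mdeg m = k}" by (auto simp: homog_def)
  then show ?thesis
    by (induction p rule: poly2_set_induct) (auto simp: hpart_mon hpart_add)
qed

lemma homog_hpart [simp]: "homog k (hpart k p)"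
  by (induction p rule: poly2_induct) (simp_all add: hpart_mon hpart_add homog_add)

lemma keys_hpart: "keys (hpart k p) \<subseteq> keys p"
  unfolding homogeneous_part_def
  by (rule order_trans[OF keys_sum]) (auto split: if_splits)

lemma hpart_Pol: "p \<in> Pol r \<Longrightarrow> hpart k p \<in> Pol r"
  using keys_hpart[of k p] by (auto simp: Pol_def)

lemma hpart_homog_mult:
  assumes "homog d u" "d \<le> k" shows "hpart k (u * q) = u * hpart (k - d) q"
proof -
  have "hpart k (u * q) = (\<Sum>j\<le>k. if d = j then u * hpart (k - d) q else 0)"
    unfolding hpart_mult by (rule sum.cong) (auto simp: hpart_homog[OF assms(1)])
  then show ?thesis using assms(2) by simp
qed

lemma hpart_homog_mult_less:
  assumes "homog d u" "k < d" shows "hpart k (u * q) = 0"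
  unfolding hpart_mult by (rule sum.neutral) (use assms in \<open>auto simp: hpart_homog[OF assms(1)]\<close>)

text \<open>Being homogeneous, \<open>u\<close> as a factor only shifts the components of its
  cofactor.\<close>

lemma hpart_dvd: "homog d u \<Longrightarrow> u dvd p \<Longrightarrow> u dvd hpart k p"
  by (elim dvdE) (metis dvd_0_right dvd_triv_left hpart_homog_mult hpart_homog_mult_less linorder_not_le)

lemma sum_hpart:
  assumes "\<And>m. m \<in> keys p \<Longrightarrow> mdeg m \<in> A" "finite A"
  shows "(\<Sum>k\<in>A. hpart k p) = p"
proof -
  have "keys p \<subseteq> {m. mdeg m \<in> A}" using assms by auto
  then show ?thesis
    by (induction p rule: poly2_set_induct) (use assms(2) in \<open>auto simp: hpart_mon hpart_add sum.distrib\<close>)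
qed

lemma sum_hpart_bound: obtains N where "\<And>M. N \<le> M \<Longrightarrow> (\<Sum>k<M. hpart k p) = p"
proof
  show "(\<Sum>k<M. hpart k p) = p" if "Suc (Max (insert 0 (mdeg ` keys p))) \<le> M" for M
    by (rule sum_hpart) (use that in \<open>auto simp: Suc_le_eq\<close>)
qed

text \<open>Without a constant term \<open>a\<close> starts in degree one or higher, hence
  \<open>a ^ N * g\<close> starts in degree \<open>N\<close> or higher.\<close>

lemma hpart_power_low:
  assumes "lookup a 0 = 0" "k < N" shows "hpart k (a ^ N * g) = 0"
proof -
  have h0: "hpart 0 a = 0"
  proof -
    have "keys a \<inter> {m. mdeg m = 0} = {}" using assms(1) by (auto simp: mdeg_eq_0_iff)
    then show ?thesis unfolding homogeneous_part_def
      by (intro sum.neutral) blast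
  qed
  show ?thesis using assms(2)
  proof (induction N arbitrary: k)
    case (Suc N)
    have "hpart k (a * (a ^ N * g)) = 0"
    proof (subst hpart_mult, rule sum.neutral, rule ballI)
      fix j assume "j \<in> {..k}"
      show "hpart j a * hpart (k - j) (a ^ N * g) = 0"
      proof (cases "j = 0")
        case False
        then have "k - j < N" using Suc.prems \<open>j \<in> {..k}\<close> by auto
        then show ?thesis by (simp add: Suc.IH)
      qed (simp add: h0)
    qed
    then show ?case by (simp add: mult.assoc)
  qed simp
qed

lemma lookup_mult_0: "lookup (p * q) 0 = lookup p 0 * lookup q (0::monom)"
  for p q :: poly2
proof (induction p rule: poly2_induct)
  case (mon a)
  show ?case
  proof (induction q rule: poly2_induct)
    case (mon b)
    show ?case
      using mdeg_eq_0_iff[of "a + b"] mdeg_eq_0_iff[of a] mdeg_eq_0_iff[of b]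
      unfolding mon_mult by (auto simp: lookup_single when_def)
  qed (simp_all add: distrib_left lookup_add del: add_bit_eq_xor mult_bit_eq_and)
qed (simp_all add: distrib_right lookup_add del: add_bit_eq_xor mult_bit_eq_and)

text \<open>The reason is that a polynomial \<open>w\<close> with constant term 1 is a unit modulo polynomials of high degree.\<close>

lemma dvd_cancel_unit:
  assumes u: "homog d u" and w: "lookup w 0 = 1" and dvd: "u dvd w * g"
  shows "u dvd g"
proof -
  obtain N where N: "\<And>M. N \<le> M \<Longrightarrow> (\<Sum>k<M. hpart k g) = g" by (rule sum_hpart_bound) blast
  define a where "a = w + 1"
  have a: "lookup a 0 = 0" using w by (simp add: a_def lookup_add)
  have "w = a - 1" by (simp add: a_def add.assoc)
  \<comment> \<open>A geometric sum: \<open>a - 1\<close> divides \<open>a ^ N - 1\<close>, so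
    \<open>w\<close> is invertible modulo \<open>a ^ N\<close>.\<close>
  then have "w dvd a ^ N - 1" by (simp only: power_diff_1_eq dvd_triv_left)
  then have "u dvd (a ^ N - 1) * g" using dvd by (meson dvd_trans mult_dvd_mono dvd_refl)
  then have "u dvd a ^ N * g + g" by (simp add: distrib_right)
  then have "u dvd hpart k (a ^ N * g + g)" for k by (rule hpart_dvd[OF u])
  \<comment> \<open>Below degree \<open>N\<close> the term \<open>a ^ N * g\<close> contributes
    nothing, and \<open>N\<close> was chosen so that these degrees exhaust \<open>g\<close>.\<close>
  then have "u dvd hpart k g" if "k < N" for k
    using hpart_power_low[OF a that] by (metis add_0 hpart_add)
  then have "u dvd (\<Sum>k<N. hpart k g)" by (intro dvd_sum) auto
  then show ?thesis using N by simp
qed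

section \<open>Polynomials dividing their total square\<close>

definition partial :: "nat \<Rightarrow> poly2 \<Rightarrow> poly2" where
  "partial i = mon_sum (\<lambda>m. if odd (lookup m i) then mon (m - unit_monom i) else 0)"

lemma partial_0 [simp]: "partial i 0 = 0" by (simp add: partial_def)

lemma partial_add: "partial i (p + q) = partial i p + partial i q" by (simp add: partial_def mon_sum_add)

lemma partial_mon: "partial i (mon m) = (if odd (lookup m i) then mon (m - unit_monom i) else 0)"
  by (simp add: partial_def)

lemma partial_mult: "partial i (p * q) = partial i p * q + p * partial i q"
proof (induction p rule: poly2_induct)
  case (mon a)
  show ?case
  proof (induction q rule: poly2_induct)
    case (mon b)
    have "a - unit_monom i + b = a + b - unit_monom i" if "odd (lookup a i)" for a b :: monom
      using that by (intro poly_mapping_eqI)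
        (auto simp: lookup_add lookup_minus lookup_single when_def elim: oddE)
    from this[of a b] this[of b a] show ?case
      by (auto simp: mon_mult partial_mon lookup_add add.commute[of _ a])
  qed (simp_all add: partial_add distrib_left add_ac)
qed (simp_all add: partial_add distrib_right add_ac)

lemma partial_1 [simp]: "partial i 1 = 0"
  using partial_mon[of i 0] by simp

lemma partial_var: "partial i (var j) = (if i = j then 1 else 0)"
  by (simp add: var_def partial_mon lookup_single when_def)

lemma unit_monom_eq_iff [simp]: "Poly_Mapping.single i (Suc 0) = Poly_Mapping.single j (Suc 0) \<longleftrightarrow> i = j"
  by (metis lookup_single_eq lookup_single_not_eq n_not_Suc_n)

lemma lookup_var: "lookup (var i) (Poly_Mapping.single j (Suc 0)) = (if i = j then 1 else 0)"
  by (simp add: var_def lookup_single when_def)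

lemma partial_square [simp]: "partial i (p\<^sup>2) = 0"
  by (simp add: power2_eq_square partial_mult mult.commute[of p "partial i p"])

lemma partial_Pol_eq_0:
  assumes "u \<in> Pol r" "r \<le> i" shows "partial i u = 0"
proof -
  have "keys u \<subseteq> {m. keys m \<subseteq> {..<r}}" using assms by (auto simp: Pol_def)
  then show ?thesis
  proof (induction u rule: poly2_set_induct)
    case (mon m)
    then have "i \<notin> keys m" using assms(2) by auto
    then show ?case by (simp add: partial_mon in_keys_iff)
  qed (simp_all add: partial_add)
qed

text \<open>The monomial \<open>n\<close> can arise only from \<open>n + unit_monom i\<close>, whose
  exponent at \<open>i\<close> is odd exactly when that of \<open>n\<close> is even.\<close>

lemma lookup_partial: "lookup (partial i u) n = (if even (lookup n i) then lookup u (n + unit_monom i) else 0)"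
proof (induction u rule: poly2_induct)
  case (mon m)
  have "m - unit_monom i = n \<longleftrightarrow> m = n + unit_monom i" if "odd (lookup m i)"
  proof -
    have "m - unit_monom i + unit_monom i = m"
      using that by (intro poly_mapping_eqI)
        (auto simp: lookup_add lookup_minus lookup_single when_def elim: oddE)
    then show ?thesis by (metis add_diff_cancel_right')
  qed
  then show ?case by (auto simp: partial_mon lookup_single when_def lookup_add)
qed (auto simp: partial_add lookup_add simp del: add_bit_eq_xor)

lemma homog_partial:
  assumes "homog k u" shows "homog (k - 1) (partial i u)"
proof -
  have "keys u \<subseteq> {m. mdeg m = k}" using assms by (auto simp: homog_def)
  then show ?thesis
  proof (induction u rule: poly2_set_induct)
    case (mon m)
    have "mdeg (m - unit_monom i) = k - 1" if "odd (lookup m i)"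
    proof -
      have "m - unit_monom i + unit_monom i = m"
        using that by (intro poly_mapping_eqI)
          (auto simp: lookup_add lookup_minus lookup_single when_def elim: oddE)
      then have "mdeg (m - unit_monom i) + 1 = mdeg m" by (metis One_nat_def mdeg_add mdeg_unit_monom)
      then show ?thesis using mon by simp
    qed
    then show ?case by (simp add: partial_mon)
  qed (simp_all add: partial_add homog_add)
qed

text \<open>If all derivatives vanish, every exponent is even. Squaring is additive in
  characteristic two and fixes the coefficients, so halving all exponents gives the root. Variables
  and degree are tracked for the later induction on the degree.\<close>

lemma poly2_square_root:
  assumes "\<And>i. partial i u = 0"
  obtains v where "u = v\<^sup>2" "\<And>r. u \<in> Pol r \<Longrightarrow> v \<in> Pol r" "\<And>k. homog k u \<Longrightarrow> homog (k div 2) v"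
proof -
  define half :: "monom \<Rightarrow> monom" where "half = Poly_Mapping.map (\<lambda>k. k div 2)"
  have lookup_half: "lookup (half m) i = lookup m i div 2" for m i
    by (simp add: half_def Poly_Mapping.map.rep_eq when_def)
  have half: "half m + half m = m" if m: "m \<in> keys u" for m
  proof (rule poly_mapping_eqI)
    fix i
    have "even (lookup m i)"
    proof (rule ccontr)
      assume odd: "odd (lookup m i)"
      then have m': "m - unit_monom i + unit_monom i = m"
        by (intro poly_mapping_eqI)
          (auto simp: lookup_add lookup_minus lookup_single when_def elim: oddE)
      have "even (lookup (m - unit_monom i) i)" using odd by (simp add: lookup_minus)
      then have "lookup u m = 0" using lookup_partial[of i u "m - unit_monom i"] assms[of i] m' by simp
      then show False using m by (simp add: in_keys_iff)
    qed
    then show "lookup (half m + half m) i = lookup m i"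
      by (auto simp: lookup_add lookup_half elim!: evenE)
  qed
  define v where "v = (\<Sum>m\<in>keys u. mon (half m))"
  have sq: "(sum f A)\<^sup>2 = (\<Sum>a\<in>A. (f a)\<^sup>2)" for f :: "monom \<Rightarrow> poly2" and A
    by (induction A rule: infinite_finite_induct) (simp_all add: poly2_square_add)
  have "v\<^sup>2 = (\<Sum>m\<in>keys u. mon m)"
    unfolding v_def sq by (rule sum.cong) (simp_all add: mon_power half)
  then have 1: "u = v\<^sup>2" using poly2_sum_mon by simp
  have keys_v: "keys v \<subseteq> half ` keys u"
    unfolding v_def by (rule order_trans[OF keys_sum]) auto
  have 2: "v \<in> Pol r" if "u \<in> Pol r" for r
  proof -
    have "keys (half m) \<subseteq> keys m" for m by (auto simp: in_keys_iff lookup_half)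
    then show ?thesis using keys_v that unfolding Pol_def by fast
  qed
  have 3: "homog (k div 2) v" if "homog k u" for k
  proof -
    have "mdeg (half m) = k div 2" if "m \<in> keys u" for m
      using half[OF that] mdeg_add[of "half m" "half m"] \<open>homog k u\<close> that by (auto simp: homog_def)
    then show ?thesis using keys_v unfolding homog_def by auto
  qed
  from that 1 2 3 show ?thesis by blast
qed

section \<open>The total square and its compatible derivations\<close>

abbreviation total_Sq :: "poly2 \<Rightarrow> poly2" where "total_Sq \<equiv> subst (\<lambda>i. var i + (var i)\<^sup>2)"

text \<open>The chain rule: the derivative of \<open>var i + (var i)\<^sup>2\<close> is 1 in
  characteristic two.\<close>

lemma partial_total_Sq: "partial i (total_Sq p) = total_Sq (partial i p)"
  by (induction p rule: poly2_alg_induct)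
    (simp_all add: subst_add subst_mult partial_add partial_mult partial_var distrib_left)

text \<open>The derivation \<open>D\<^sub>j\<close>, sending each of the first \<open>r\<close>
  variables \<open>x\<close> to \<open>x ^ 2 ^ j\<close>: the Euler operator for
  \<open>j = 0\<close>, and for \<open>j > 0\<close> the action of the Milnor primitive of degree
  \<open>2 ^ j - 1\<close>.\<close>

definition frob_deriv :: "nat \<Rightarrow> nat \<Rightarrow> poly2 \<Rightarrow> poly2" where
  "frob_deriv r j u = (\<Sum>i<r. var i ^ 2 ^ j * partial i u)"

lemma frob_deriv_mult: "frob_deriv r j (p * q) = frob_deriv r j p * q + p * frob_deriv r j q"
  by (simp add: frob_deriv_def partial_mult distrib_left sum.distrib sum_distrib_left sum_distrib_right mult_ac)

text \<open>The Frobenius identity splits \<open>(x + x\<^sup>2) ^ 2 ^ j\<close> into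
  \<open>x ^ 2 ^ j + x ^ 2 ^ Suc j\<close>, and partial derivatives commute with
  \<open>total_Sq\<close>.\<close>

lemma frob_deriv_total_Sq:
  "total_Sq (frob_deriv r j u) = frob_deriv r j (total_Sq u) + frob_deriv r (Suc j) (total_Sq u)"
proof -
  have "total_Sq (sum f A) = (\<Sum>a\<in>A. total_Sq (f a))" for f :: "nat \<Rightarrow> poly2" and A
    by (induction A rule: infinite_finite_induct) (simp_all add: subst_add)
  then have "total_Sq (frob_deriv r j u) = (\<Sum>i<r. (var i + (var i)\<^sup>2) ^ 2 ^ j * total_Sq (partial i u))"
    by (simp add: frob_deriv_def subst_mult subst_power)
  also have "\<dots> = frob_deriv r j (total_Sq u) + frob_deriv r (Suc j) (total_Sq u)"
    unfolding frob_deriv_def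
    by (simp add: poly2_power2_power_add partial_total_Sq distrib_right sum.distrib power_mult)
  finally show ?thesis .
qed

text \<open>On a monomial, \<open>var i * partial i\<close> multiplies by the exponent of variable
  \<open>i\<close>, and these exponents add up to the degree.\<close>

lemma Euler:
  assumes "u \<in> Pol r" "homog k u" shows "frob_deriv r 0 u = (if odd k then u else 0)"
proof -
  have "keys u \<subseteq> {m. keys m \<subseteq> {..<r} \<and> mdeg m = k}"
    using assms by (auto simp: Pol_def homog_def)
  then show ?thesis
  proof (induction u rule: poly2_set_induct)
    case (mon m)
    have "frob_deriv r 0 (mon m) = (\<Sum>i<r. if odd (lookup m i) then mon m else 0)"
      unfolding frob_deriv_def
    proof (rule sum.cong[OF refl])
      fix i
      have "unit_monom i + (m - unit_monom i) = m" if "odd (lookup m i)"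
        using that by (intro poly_mapping_eqI)
          (auto simp: lookup_add lookup_minus lookup_single when_def elim: oddE)
      then show "var i ^ 2 ^ 0 * partial i (mon m) = (if odd (lookup m i) then mon m else 0)"
        by (simp add: partial_mon var_def mon_mult)
    qed
    \<comment> \<open>The range is renamed \<open>A\<close> so that the parity of the sum follows by
      induction on an arbitrary set.\<close>
    also have "\<dots> = (if odd (\<Sum>i\<in>A. lookup m i) then mon m else 0)"
      if "A = {..<r}" for A
      unfolding that[symmetric]
      by (induction A rule: infinite_finite_induct) auto
    finally show ?case using mon mdeg_superset[of "{..<r}" m] by simp
  next
    case (add p q)
    have "frob_deriv r 0 (p + q) = frob_deriv r 0 p + frob_deriv r 0 q"
      by (simp add: frob_deriv_def partial_add distrib_left sum.distrib)
    with add show ?case by simp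
  qed (simp add: frob_deriv_def)
qed

text \<open>If \<open>D\<^sub>j u\<close> is a multiple of \<open>u\<close>, then so are its total
  square and, by the Leibniz rule, \<open>D\<^sub>j (w * u)\<close>. Hence \<open>u\<close> divides
  the difference \<open>D\<^sub>j\<^sub>+\<^sub>1 (w * u)\<close>, which is
  \<open>w * D\<^sub>j\<^sub>+\<^sub>1 u\<close> modulo \<open>u\<close>; the constant term 1 of
  \<open>w\<close> permits cancelling it.\<close>

lemma frob_deriv_dvd:
  assumes u: "u \<in> Pol r" "homog k u" and w: "total_Sq u = w * u" "lookup w 0 = 1"
  shows "u dvd frob_deriv r j u"
proof (induction j)
  case 0
  then show ?case using Euler[OF u] by simp
next
  case (Suc j)
  then obtain a where a: "frob_deriv r j u = u * a" by blast
  have "u dvd total_Sq (frob_deriv r j u)" by (simp add: a subst_mult w)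
  moreover have "u dvd frob_deriv r j (total_Sq u)" by (simp add: w frob_deriv_mult a)
  ultimately have "u dvd frob_deriv r (Suc j) (total_Sq u)"
    unfolding frob_deriv_total_Sq by (simp add: dvd_add_right_iff)
  then have "u dvd w * frob_deriv r (Suc j) u"
    by (simp add: w frob_deriv_mult dvd_add_right_iff)
  then show ?case by (rule dvd_cancel_unit[OF u(2) w(2)])
qed

section \<open>Additive polynomials, encoded as functions\<close>

inductive additive_poly :: "(poly2 \<Rightarrow> poly2) \<Rightarrow> bool" where
  power: "additive_poly (\<lambda>X. c * X ^ 2 ^ j)"
| add: "additive_poly f \<Longrightarrow> additive_poly g \<Longrightarrow> additive_poly (\<lambda>X. f X + g X)"

lemma additive_poly_add: "additive_poly f \<Longrightarrow> f (X + Y) = f X + f Y"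
  by (induction rule: additive_poly.induct) (simp_all add: poly2_power2_power_add distrib_left)

lemma additive_poly_scale: "additive_poly f \<Longrightarrow> additive_poly (\<lambda>X. c * f X)"
proof (induction rule: additive_poly.induct)
  case (power d j)
  show ?case using additive_poly.power[of "c * d" j] by (simp add: mult_ac)
next
  case (add f g)
  then show ?case using additive_poly.add by (simp add: distrib_left)
qed

lemma additive_poly_square: "additive_poly f \<Longrightarrow> additive_poly (\<lambda>X. (f X)\<^sup>2)"
proof (induction rule: additive_poly.induct)
  case (power c j)
  show ?case using additive_poly.power[of "c\<^sup>2" "Suc j"]
    by (simp add: power_mult_distrib power_mult mult.commute[of 2])
next
  case (add f g)
  then show ?case using additive_poly.add by (simp add: poly2_square_add)
qed

text \<open>For a single term \<open>c * X ^ 2 ^ j\<close> the sum is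
  \<open>c * frob_deriv r j u\<close>, so in general it is a linear combination of such derivations
  of \<open>u\<close>.\<close>

lemma additive_poly_dvd:
  assumes "additive_poly f" "\<And>j. u dvd frob_deriv r j u"
  shows "u dvd (\<Sum>i<r. f (var i) * partial i u)"
  using assms(1)
proof induction
  case (power c j)
  have "(\<Sum>i<r. c * var i ^ 2 ^ j * partial i u) = c * frob_deriv r j u"
    by (simp add: frob_deriv_def sum_distrib_left mult_ac)
  then show ?case using assms(2) by simp
qed (simp add: distrib_right sum.distrib)

text \<open>The product of \<open>X + \<theta>\<close> over all subset sums \<theta> of the listed
  variables. Adjoining \<open>a\<close> splits these into two cosets, and the second contributes
  \<open>f (X + var a) = f X + f (var a)\<close> for the additive
  \<open>f = span_poly as\<close>.\<close>

fun span_poly :: "nat list \<Rightarrow> poly2 \<Rightarrow> poly2" where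
  "span_poly [] X = X"
| "span_poly (a # as) X = span_poly as X * (span_poly as X + span_poly as (var a))"

lemma additive_span_poly: "additive_poly (span_poly as)"
proof (induction as)
  case Nil
  show ?case using additive_poly.power[of 1 0] by (simp add: fun_eq_iff[symmetric])
next
  case (Cons a as)
  have "span_poly (a # as) = (\<lambda>X. (span_poly as X)\<^sup>2 + span_poly as (var a) * span_poly as X)"
    by (simp add: fun_eq_iff power2_eq_square algebra_simps)
  then show ?case
    using additive_poly.add[OF additive_poly_square[OF Cons] additive_poly_scale[OF Cons]] by simp
qed

text \<open>One of the factors is \<open>X + var a\<close>, which vanishes at
  \<open>X = var a\<close>.\<close>

lemma span_poly_var: "a \<in> set as \<Longrightarrow> span_poly as (var a) = 0"
  by (induction as) auto

definition linear_forms :: "nat \<Rightarrow> poly2 set" where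
  "linear_forms r = {p \<in> Pol r. homog 1 p}"

text \<open>All factors \<open>X + \<theta>\<close> keep coefficient 1 at a variable
  \<open>i\<close> outside the list, hence are nonzero. Adjoining \<open>a\<close> requires the
  claim for both \<open>X\<close> and \<open>X + var a\<close>, which is why \<open>X\<close> is
  generalized.\<close>

lemma span_poly_product:
  assumes "X \<in> linear_forms r" "lookup X (unit_monom i) = 1" "i \<notin> set as" "set as \<subseteq> {..<r}"
  shows "\<exists>ts. set ts \<subseteq> linear_forms r - {0} \<and> span_poly as X = prod_list ts"
  using assms
proof (induction as arbitrary: X)
  case Nil
  then show ?case by (intro exI[of _ "[X]"]) auto
next
  case (Cons a as)
  obtain ts where ts: "set ts \<subseteq> linear_forms r - {0}" "span_poly as X = prod_list ts"
    using Cons.IH[OF Cons.prems(1,2)] Cons.prems(3,4) by auto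
  have "lookup (var a) (unit_monom i) = 0" using Cons.prems by (auto simp: var_def lookup_single when_def)
  moreover have "var a \<in> linear_forms r" using Cons.prems by (simp add: linear_forms_def Pol_var homog_var)
  ultimately have "\<exists>ts. set ts \<subseteq> linear_forms r - {0} \<and> span_poly as (X + var a) = prod_list ts"
    using Cons by (intro Cons.IH) (auto simp: linear_forms_def Pol_add homog_add lookup_add)
  then obtain ts' where ts': "set ts' \<subseteq> linear_forms r - {0}" "span_poly as (X + var a) = prod_list ts'"
    by blast
  have "span_poly (a # as) X = prod_list (ts @ ts')"
    by (simp add: ts ts'(2)[symmetric] additive_poly_add[OF additive_span_poly])
  then show ?case using ts ts' by (intro exI[of _ "ts @ ts'"]) auto
qed

section \<open>Linear forms as prime elements\<close>

lemma mdeg_eq_1: "mdeg m = 1 \<Longrightarrow> \<exists>j. m = unit_monom j"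
  by (induction m rule: monom_induct) (auto simp: mdeg_eq_0_iff)

text \<open>Substituting \<open>var i + \<theta>\<close> for a variable \<open>var i\<close>
  occurring in \<theta> kills \<theta> and changes every polynomial by a multiple of \<theta>. A
  product divisible by \<theta> is sent to zero, so one factor is, the polynomial ring being an
  integral domain.\<close>

lemma linear_form_prime:
  assumes "homog 1 \<theta>" "\<theta> \<noteq> 0" "\<theta> dvd p * q"
  shows "\<theta> dvd p \<or> \<theta> dvd q"
proof -
  obtain m where m: "m \<in> keys \<theta>" using assms(2) by (metis equals0I keys_eq_empty)
  then obtain i where i: "m = unit_monom i" using assms(1) mdeg_eq_1 by (metis homog_def)
  define s where "s j = (if j = i then var i + \<theta> else var j)" for j
  \<comment> \<open>The part of \<theta> without \<open>var i\<close>; the substitution fixes it and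
    sends \<open>var i\<close> to it.\<close>
  define \<theta>' where "\<theta>' = \<theta> + var i"
  have "keys \<theta>' \<subseteq> {unit_monom j | j. j \<noteq> i}"
  proof
    fix k assume k: "k \<in> keys \<theta>'"
    have "homog 1 \<theta>'" unfolding \<theta>'_def using assms(1) by (intro homog_add) simp_all
    then obtain j where j: "k = unit_monom j" using mdeg_eq_1 k by (metis homog_def)
    have "lookup \<theta>' (unit_monom i) = 0" using m i by (simp add: \<theta>'_def lookup_add var_def in_keys_iff)
    then show "k \<in> {unit_monom j | j. j \<noteq> i}" using k j by (auto simp: in_keys_iff)
  qed
  then have "subst s \<theta>' = \<theta>'"
  proof (induction \<theta>' rule: poly2_set_induct)
    case (mon m)
    then obtain j where "m = unit_monom j" "j \<noteq> i" by auto
    then have "s j = var j" by (simp add: s_def)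
    then show ?case using subst_var[of s j] by (simp add: var_def \<open>m = unit_monom j\<close>)
  qed (simp_all add: subst_add)
  moreover have "\<theta> = \<theta>' + var i" by (simp add: \<theta>'_def add.assoc)
  ultimately have "subst s \<theta> = \<theta>' + (var i + \<theta>)" by (simp add: subst_add s_def)
  then have s\<theta>: "subst s \<theta> = 0" by (simp add: \<theta>'_def add_ac)
  have cong: "\<theta> dvd subst s p + p" for p
  proof (induction p rule: poly2_alg_induct)
    case (add p q)
    have "subst s (p + q) + (p + q) = (subst s p + p) + (subst s q + q)" by (simp add: subst_add add_ac)
    then show ?case using add by (metis dvd_add)
  next
    case (mult p j)
    have "subst s (p * var j) + p * var j = (subst s p + p) * s j + p * (s j + var j)"
      by (simp add: subst_mult distrib_left distrib_right add_ac)
    moreover have "\<theta> dvd s j + var j" by (simp add: s_def add_ac)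
    ultimately show ?case using mult by simp
  qed simp_all
  obtain c where "p * q = \<theta> * c" using assms(3) by blast
  then have "subst s p * subst s q = 0" by (metis s\<theta> mult_zero_left subst_mult)
  then have "subst s p = 0 \<or> subst s q = 0" by simp
  then show ?thesis using cong[of p] cong[of q] by auto
qed

text \<open>Each \<theta> in the list is prime and does not divide \<open>u\<close>, so it divides
  the cofactor of \<open>u\<close> and cancels.\<close>

lemma dvd_cancel_linear_forms:
  assumes "set ts \<subseteq> linear_forms r - {0}" "u dvd prod_list ts * g"
    "\<And>\<theta>. \<theta> \<in> linear_forms r - {0} \<Longrightarrow> \<not> \<theta> dvd u"
  shows "u dvd g"
  using assms(1,2)
proof (induction ts)
  case (Cons \<theta> ts)
  then have \<theta>: "\<theta> \<in> linear_forms r" "\<theta> \<noteq> 0" by auto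
  obtain c where c: "\<theta> * (prod_list ts * g) = u * c" using Cons.prems by (auto simp: mult.assoc)
  then have "\<theta> dvd u * c" by (metis dvd_triv_left)
  then have "\<theta> dvd c" using linear_form_prime[of \<theta> u c] \<theta> assms(3) by (auto simp: linear_forms_def)
  then obtain c' where "c = \<theta> * c'" by blast
  then have "\<theta> * (prod_list ts * g) = \<theta> * (u * c')" using c by (simp add: mult_ac)
  then have "prod_list ts * g = u * c'" using \<theta> by simp
  then show ?case using Cons by simp
qed simp

lemma homog_dvd_degree:
  assumes "homog m u" "homog k g" "g \<noteq> 0" "u dvd g" shows "m \<le> k"
proof (rule ccontr)
  assume "\<not> m \<le> k"
  obtain q where "g = u * q" using assms by blast
  then have "hpart k g = 0" using hpart_homog_mult_less[OF assms(1)] \<open>\<not> m \<le> k\<close> by simp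
  then show False using hpart_homog[OF assms(2), of k] assms(3) by simp
qed

text \<open>The degree drops by one when a linear form is split off and is halved when
  \<open>u\<close> is a square. Both moves change the cofactor \<open>w\<close>, so it is
  generalized together with \<open>u\<close>.\<close>

theorem Sq_stable_product:
  assumes "u \<in> Pol r" "homog m u" "u \<noteq> 0" "total_Sq u = w * u" "lookup w 0 = 1"
  shows "\<exists>ts. set ts \<subseteq> linear_forms r - {0} \<and> u = prod_list ts"
  using assms
proof (induction m arbitrary: u w rule: less_induct)
  case (less m)
  note u = less.prems(1-3) and w = less.prems(4,5)
  consider "m = 0" | "m > 0" "\<exists>\<theta>\<in>linear_forms r - {0}. \<theta> dvd u"
    | "m > 0" "\<And>\<theta>. \<theta> \<in> linear_forms r - {0} \<Longrightarrow> \<not> \<theta> dvd u" by blast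
  then show ?case
  proof cases
    case 1
    then have "keys u \<subseteq> {0}" using u(2) by (auto simp: homog_def mdeg_eq_0_iff)
    moreover have "keys u \<noteq> {}" using u(3) by simp
    ultimately have "keys u = {0}" by blast
    then have "u = 1" using poly2_sum_mon[of u] by simp
    then show ?thesis by (intro exI[of _ "[]"]) simp
  next
    case 2
    then obtain \<theta> q where \<theta>: "\<theta> \<in> linear_forms r" "\<theta> \<noteq> 0" and q: "u = \<theta> * q" by blast
    have \<theta>1: "homog 1 \<theta>" "\<theta> \<in> Pol r" using \<theta> by (simp_all add: linear_forms_def)
    \<comment> \<open>The quotient \<open>q\<close> lives in the big ring; restricting its variables
      and taking the part of degree \<open>m - 1\<close> gives a cofactor to which the induction
      hypothesis applies.\<close>
    define v where "v = hpart (m - 1) (restrict_vars r q)"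
    have "u = restrict_vars r u" using u by (simp add: restrict_vars_id)
    also have "\<dots> = \<theta> * restrict_vars r q" using restrict_vars_id[OF \<theta>1(2)] by (simp add: q restrict_vars_def subst_mult)
    finally have "hpart m u = \<theta> * v" using hpart_homog_mult[OF \<theta>1(1), of m] 2 by (simp add: v_def)
    then have v: "u = \<theta> * v" using hpart_homog[OF u(2), of m] by simp
    have v1: "v \<in> Pol r" "homog (m - 1) v" "v \<noteq> 0"
      using u v by (auto simp: v_def hpart_Pol restrict_vars_Pol)
    have "total_Sq \<theta> = \<theta> * (1 + \<theta>)"
    proof -
      have "keys \<theta> \<subseteq> {m. mdeg m = 1}" using \<theta>1 by (auto simp: homog_def)
      then have "total_Sq \<theta> = \<theta> + \<theta>\<^sup>2"
      proof (induction \<theta> rule: poly2_set_induct)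
        case (mon m)
        then obtain j where "m = unit_monom j" using mdeg_eq_1 by auto
        then show ?case using subst_var[of _ j] by (simp add: var_def)
      qed (simp_all add: subst_add poly2_square_add add_ac)
      then show ?thesis by (simp add: distrib_left power2_eq_square)
    qed
    then have "\<theta> * ((1 + \<theta>) * total_Sq v) = \<theta> * (w * v)"
      using w(1) by (simp add: v subst_mult mult_ac)
    then have *: "(1 + \<theta>) * total_Sq v = w * v" using \<theta> by simp
    have \<theta>0: "lookup (1 + \<theta>) 0 = 1"
    proof -
      have "0 \<notin> keys \<theta>" using \<theta>1(1) by (auto simp: homog_def)
      then show ?thesis by (simp add: lookup_add in_keys_iff)
    qed
    \<comment> \<open>Since \<open>1 + \<theta>\<close> has constant term 1, it can be cancelled
      from \<open>(1 + \<theta>) * total_Sq v = w * v\<close>.\<close>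
    have "v dvd total_Sq v"
      by (rule dvd_cancel_unit[OF v1(2) \<theta>0]) (simp add: *)
    then obtain w' where w': "total_Sq v = w' * v" by (metis dvdE mult.commute)
    then have "((1 + \<theta>) * w') * v = w * v" using * by (simp add: mult.assoc)
    then have "(1 + \<theta>) * w' = w" using v1(3) by simp
    then have "lookup w' 0 = 1" using w(2) \<theta>0 lookup_mult_0[of "1 + \<theta>" w'] by auto
    then obtain ts where "set ts \<subseteq> linear_forms r - {0}" "v = prod_list ts"
      using less.IH[OF _ v1 w'] 2 by auto
    then show ?thesis using v \<theta> by (intro exI[of _ "\<theta> # ts"]) auto
  next
    case 3
    have partial0: "partial i u = 0" for i
    proof (cases "i < r")
      case True
      \<comment> \<open>All variables but \<open>var i\<close>: \<open>span_poly as\<close> kills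
        each of them, so a single summand survives.\<close>
      define as where "as = filter (\<lambda>j. j \<noteq> i) [0..<r]"
      have as: "set as = {..<r} - {i}" by (auto simp: as_def)
      have "u dvd (\<Sum>j<r. span_poly as (var j) * partial j u)"
        by (rule additive_poly_dvd[OF additive_span_poly frob_deriv_dvd[OF u(1,2) w]])
      also have "(\<Sum>j<r. span_poly as (var j) * partial j u) =
          (\<Sum>j<r. if j = i then span_poly as (var i) * partial i u else 0)"
        by (rule sum.cong) (auto simp: as span_poly_var)
      also have "\<dots> = span_poly as (var i) * partial i u" using True by simp
      finally have dvd: "u dvd span_poly as (var i) * partial i u" .
      obtain ts where ts: "set ts \<subseteq> linear_forms r - {0}" "span_poly as (var i) = prod_list ts"
        using span_poly_product[of "var i" r i as] True as Pol_var[OF True] homog_var[of i]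
        by (auto simp: linear_forms_def lookup_var)
      have "u dvd partial i u"
        by (rule dvd_cancel_linear_forms[OF ts(1)]) (use dvd ts 3 in auto)
      \<comment> \<open>A nonzero \<open>partial i u\<close> would have degree \<open>m - 1\<close>,
        too small for a multiple of \<open>u\<close>.\<close>
      then show ?thesis
        using homog_dvd_degree[OF u(2) homog_partial[OF u(2)]] 3(1) by (metis Suc_pred' diff_Suc_1 not_less_eq_eq order_refl One_nat_def)
    qed (use partial_Pol_eq_0[OF u(1)] in simp)
    obtain v where v: "u = v\<^sup>2" "v \<in> Pol r" "homog (m div 2) v"
      using poly2_square_root[OF partial0] u by metis
    have v0: "v \<noteq> 0" using v u by auto
    have sq: "(total_Sq v)\<^sup>2 = w * v\<^sup>2" using w v by (simp add: subst_power)
    \<comment> \<open>Differentiating \<open>(total_Sq v)\<^sup>2 = w * v\<^sup>2\<close> kills both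
      squares, and only the derivative of \<open>w\<close> remains; hence \<open>w\<close> is a
      square too.\<close>
    have "partial i w * v\<^sup>2 = 0" for i
      using arg_cong[OF sq, of "partial i"] by (simp add: partial_mult)
    then have "partial i w = 0" for i using v0 by simp
    then obtain w' where w': "w = w'\<^sup>2" using poly2_square_root by metis
    have TSv: "total_Sq v = w' * v"
      by (rule poly2_square_inj) (simp add: sq w' power_mult_distrib)
    have "lookup w' 0 = 1" using w(2) lookup_mult_0[of w' w'] by (simp add: w' power2_eq_square)
    then obtain ts where "set ts \<subseteq> linear_forms r - {0}" "v = prod_list ts"
      using less.IH[OF _ v(2,3) v0 TSv] 3(1) by auto
    then show ?thesis using v by (intro exI[of _ "ts @ ts"]) (auto simp: power2_eq_square)
  qed
qed

section \<open>Steenrod squares on polynomials\<close>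

lemma total_square_eq: "total_square m = total_Sq (mon m)"
  by (simp add: total_square_def subst_def)

text \<open>In the total square of a monomial every variable factor contributes \<open>x\<close> or
  \<open>x\<^sup>2\<close>. The degrees thus range from \<open>k\<close> to \<open>2 * k\<close>,
  and the two extremes make the same choice throughout.\<close>

lemma total_Sq_degrees:
  assumes "homog k p"
  shows "j < k \<or> 2 * k < j \<Longrightarrow> hpart j (total_Sq p) = 0"
    and "hpart k (total_Sq p) = p" and "hpart (2 * k) (total_Sq p) = p\<^sup>2"
proof -
  have mon: "(\<forall>j. j < mdeg m \<or> 2 * mdeg m < j \<longrightarrow> hpart j (total_Sq (mon m)) = 0) \<and>
    hpart (mdeg m) (total_Sq (mon m)) = mon m \<and> hpart (2 * mdeg m) (total_Sq (mon m)) = (mon m)\<^sup>2" for m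
  proof (induction m rule: monom_induct)
    case zero
    show ?case by (auto simp: hpart_homog[OF homog_1])
  next
    case (add m i)
    let ?T = "total_Sq (mon m)"
    have var2: "homog 2 ((var i)\<^sup>2)" using homog_mult[of 1 "var i" 1 "var i"]
      by (simp add: power2_eq_square numeral_2_eq_2)
    have eq: "mon (m + unit_monom i) = mon m * var i" by (simp add: var_def mon_mult)
    \<comment> \<open>Multiplication by \<open>x + x\<^sup>2\<close> shifts components by one or
      two; the guards deal with truncated subtraction.\<close>
    have step: "hpart j (total_Sq (mon (m + unit_monom i))) =
        (if 1 \<le> j then var i * hpart (j - 1) ?T else 0) +
        (if 2 \<le> j then (var i)\<^sup>2 * hpart (j - 2) ?T else 0)" for j
    proof -
      have "total_Sq (mon (m + unit_monom i)) = var i * ?T + (var i)\<^sup>2 * ?T"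
        unfolding eq by (simp add: subst_mult distrib_right mult.commute)
      then show ?thesis
        using hpart_homog_mult[of 1 "var i" j ?T] hpart_homog_mult_less[of 1 "var i" j ?T]
          hpart_homog_mult[OF var2, of j ?T] hpart_homog_mult_less[OF var2, of j ?T]
        by (auto simp: hpart_add not_le)
    qed
    have "hpart (mdeg m - 1) ?T = 0" if "mdeg m \<noteq> 0" using add that by simp
    moreover have "hpart (Suc (2 * mdeg m)) ?T = 0" using add by simp
    ultimately show ?case
      using add unfolding step by (auto simp: eq[unfolded One_nat_def] power2_eq_square mult_ac)
  qed
  have "keys p \<subseteq> {m. mdeg m = k}" using assms by (auto simp: homog_def)
  then have "(j < k \<or> 2 * k < j \<longrightarrow> hpart j (total_Sq p) = 0) \<and>
      hpart k (total_Sq p) = p \<and> hpart (2 * k) (total_Sq p) = p\<^sup>2"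
    by (induction p rule: poly2_set_induct)
      (use mon in \<open>auto simp: subst_add hpart_add poly2_square_add\<close>)
  then show "j < k \<or> 2 * k < j \<Longrightarrow> hpart j (total_Sq p) = 0" "hpart k (total_Sq p) = p" "hpart (2 * k) (total_Sq p) = p\<^sup>2"
    by auto
qed

lemma Hstar_Sq_eq: "Hstar_Sq i = mon_sum (\<lambda>m. hpart (mdeg m + i) (total_Sq (mon m)))"
  by (simp add: fun_eq_iff Hstar_Sq_def mon_sum_def total_square_eq)

lemma Hstar_Sq_0_right [simp]: "Hstar_Sq i 0 = 0"
  by (simp add: Hstar_Sq_eq)

lemma Hstar_Sq_add: "Hstar_Sq i (p + q) = Hstar_Sq i p + Hstar_Sq i q"
  by (simp add: Hstar_Sq_eq mon_sum_add)

lemma Hstar_Sq_homog: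
  assumes "homog k p" shows "Hstar_Sq i p = hpart (k + i) (total_Sq p)"
proof -
  have "keys p \<subseteq> {m. mdeg m = k}" using assms by (auto simp: homog_def)
  then show ?thesis
    by (induction p rule: poly2_set_induct) (auto simp: Hstar_Sq_eq mon_sum_add subst_add hpart_add)
qed

lemma Hstar_Sq_eq_0: "homog k p \<Longrightarrow> k < i \<Longrightarrow> Hstar_Sq i p = 0"
  using total_Sq_degrees(1)[of k p "k + i"] by (simp add: Hstar_Sq_homog)

lemma Hstar_Sq_top: "homog k p \<Longrightarrow> Hstar_Sq k p = p\<^sup>2"
  using total_Sq_degrees(3)[of k p] by (simp add: Hstar_Sq_homog mult_2)

lemma Hstar_Sq_0: "Hstar_Sq 0 p = p"
proof (induction p rule: poly2_induct)
  case (mon m)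
  show ?case using total_Sq_degrees(2)[of "mdeg m" "mon m"] by (simp add: Hstar_Sq_homog[of "mdeg m"])
qed (simp_all add: Hstar_Sq_add)

lemma Hstar_Sq_Pol: "p \<in> Pol r \<Longrightarrow> Hstar_Sq i p \<in> Pol r"
  unfolding Hstar_Sq_def total_square_eq
  by (intro Pol_sum hpart_Pol subst_Pol Pol_add Pol_power Pol_var) (auto simp: Pol_def)

text \<open>The component of degree \<open>k + i\<close> is the square with index \<open>i\<close>,
  and components outside degrees \<open>k\<close> to \<open>2 * k\<close> vanish.\<close>

lemma total_Sq_eq_sum: 
  assumes "homog k p" shows "total_Sq p = (\<Sum>i\<le>k. Hstar_Sq i p)"
proof -
  obtain N where N: "\<And>M. N \<le> M \<Longrightarrow> (\<Sum>j<M. hpart j (total_Sq p)) = total_Sq p"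
    by (rule sum_hpart_bound) blast
  define M where "M = max N (Suc (2 * k))"
  have "total_Sq p = (\<Sum>j<M. hpart j (total_Sq p))" using N[of M] by (simp add: M_def)
  also have "\<dots> = (\<Sum>j\<in>(+) k ` {..k}. hpart j (total_Sq p))"
  proof (rule sum.mono_neutral_right)
    show "\<forall>j\<in>{..<M} - (+) k ` {..k}. hpart j (total_Sq p) = 0"
    proof
      fix j assume j: "j \<in> {..<M} - (+) k ` {..k}"
      have "j \<in> (+) k ` {..k}" if "k \<le> j" "j \<le> 2 * k"
        using that by (intro image_eqI[of _ _ "j - k"]) auto
      then show "hpart j (total_Sq p) = 0" using j total_Sq_degrees(1)[OF assms, of j] by force
    qed
  qed (auto simp: M_def)
  also have "\<dots> = (\<Sum>i\<le>k. Hstar_Sq i p)"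
    by (subst sum.reindex) (simp_all add: Hstar_Sq_homog[OF assms])
  finally show ?thesis .
qed

text \<open>The Cartan formula is multiplicativity of the total square, read off in degree
  \<open>mdeg a + mdeg b + i\<close>. A splitting of this degree contributes only if neither part
  lies below the degree of its monomial, so the first part is \<open>mdeg a + j\<close> with
  \<open>j \<le> i\<close>.\<close>

lemma Hstar_Sq_mult: "Hstar_Sq i (p * q) = (\<Sum>j\<le>i. Hstar_Sq j p * Hstar_Sq (i - j) q)"
proof (induction p rule: poly2_induct)
  case (mon a)
  show ?case
  proof (induction q rule: poly2_induct)
    case (mon b)
    let ?k = "mdeg a" and ?l = "mdeg b"
    let ?S = "{..?k + ?l + i}"
    let ?f = "\<lambda>s. hpart s (total_Sq (mon a)) * hpart (?k + ?l + i - s) (total_Sq (mon b))"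
    have hk: "homog ?k (mon a)" and hl: "homog ?l (mon b)" by simp_all
    have "Hstar_Sq i (mon a * mon b) = sum ?f ?S"
      using Hstar_Sq_homog[OF homog_mult[OF hk hl]]
      by (simp add: subst_mult hpart_mult)
    also have "\<dots> = sum ?f ((+) ?k ` {..i})"
    proof (rule sum.mono_neutral_right)
      show "\<forall>s\<in>?S - (+) ?k ` {..i}. ?f s = 0"
      proof
        fix s assume s: "s \<in> ?S - (+) ?k ` {..i}"
        have "s \<in> (+) ?k ` {..i}" if "?k \<le> s" "s \<le> ?k + i"
          using that by (intro image_eqI[of _ _ "s - ?k"]) auto
        with s have "s < ?k \<or> ?k + ?l + i - s < ?l" by force
        then show "?f s = 0" using total_Sq_degrees(1)[OF hk, of s] total_Sq_degrees(1)[OF hl] by auto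
      qed
    qed auto
    also have "\<dots> = (\<Sum>j\<le>i. Hstar_Sq j (mon a) * Hstar_Sq (i - j) (mon b))"
    proof (subst sum.reindex)
      have "?k + ?l + i - (?k + j) = ?l + (i - j)" if "j \<le> i" for j using that by simp
      then show "sum (?f \<circ> (+) ?k) {..i} = (\<Sum>j\<le>i. Hstar_Sq j (mon a) * Hstar_Sq (i - j) (mon b))"
        by (intro sum.cong) (simp_all add: Hstar_Sq_homog[OF hk] Hstar_Sq_homog[OF hl])
    qed simp
    finally show ?case .
  qed (simp_all add: distrib_left Hstar_Sq_add sum.distrib)
qed (simp_all add: distrib_right Hstar_Sq_add sum.distrib)

section \<open>The carrier and grading of \<open>Hstar V\<close>\<close>

lemma carrier_Hstar: "carrier (Hstar V) = Pol (rank V)"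
  by (simp add: Hstar_def Pol_def)

lemma Hstar_ops [simp]:
  "p \<oplus>\<^bsub>Hstar V\<^esub> q = p + q" "p \<otimes>\<^bsub>Hstar V\<^esub> q = p * q" "\<zero>\<^bsub>Hstar V\<^esub> = 0" "\<one>\<^bsub>Hstar V\<^esub> = 1"
  by (simp_all add: Hstar_def)

lemma Hstar_gr_nat: "Hstar_gr V (int k) = {p \<in> Pol (rank V). homog k p}"
  by (auto simp: Hstar_gr_def carrier_Hstar homog_def)

lemma linear_forms_eq: "linear_forms (rank V) = Hstar_gr V 1"
  using Hstar_gr_nat[of V 1] by (simp add: linear_forms_def)

text \<open>
  The coefficients of \<open>w\<close> are those of the total square of the generator of a free module of rank one;
  the hypothesis is what remains of the Adem relations for \<open>Sq\<^sup>a Sq\<^sup>m\<close>.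
\<close>

lemma Adem_imp_total_square:
  fixes w :: "nat \<Rightarrow> poly2"
  assumes w: "\<And>i. homog i (w i)" "w 0 = 1" "\<And>i. m < i \<Longrightarrow> w i = 0"
    and Adem: "\<And>a. (\<Sum>j\<le>a. Hstar_Sq j (w m) * w (a - j)) = (if even a then (w (a div 2))\<^sup>2 * w m else 0)"
  shows "total_Sq (w m) = (\<Sum>i\<le>m. w i) * w m" "lookup (\<Sum>i\<le>m. w i) 0 = 1"
    "Hstar_Sq i (w m) = w i * w m"
proof -
  define W where "W = (\<Sum>i\<le>m. w i)"
  have "lookup (w i) 0 = (if i = 0 then 1 else 0)" for i
  proof (cases "i = 0")
    case False
    then have "0 \<notin> keys (w i)" using w(1)[of i] by (auto simp: homog_def)
    then show ?thesis using False by (simp add: in_keys_iff)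
  qed (simp add: w)
  then show W0: "lookup (\<Sum>i\<le>m. w i) 0 = 1" by (simp add: lookup_sum)
  \<comment> \<open>The powers of 1 turn both sums into polynomials evaluated at 1, as the Cauchy
    product requires.\<close>
  have "total_Sq (w m) * W = (\<Sum>j\<le>m. Hstar_Sq j (w m) * 1 ^ j) * (\<Sum>i\<le>m. w i * 1 ^ i)"
    using total_Sq_eq_sum[OF w(1), of m] by (simp add: W_def)
  also have "\<dots> = (\<Sum>a\<le>m + m. (\<Sum>j\<le>a. Hstar_Sq j (w m) * w (a - j)) * 1 ^ a)"
    by (rule polynomial_product) (simp_all add: w Hstar_Sq_eq_0[OF w(1)])
  also have "\<dots> = (\<Sum>a\<le>m + m. if even a then (w (a div 2))\<^sup>2 * w m else 0)"
    by (simp add: Adem)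
  \<comment> \<open>Only even \<open>a = 2 * c\<close> contribute, leaving the sum of the
    \<open>(w c)\<^sup>2\<close>, which is \<open>W\<^sup>2\<close> by additivity of
    squaring.\<close>
  also have "\<dots> = (\<Sum>a\<in>(*) 2 ` {..m}. (w (a div 2))\<^sup>2 * w m)"
    by (rule sum.mono_neutral_cong_right) (auto elim!: evenE)
  also have "\<dots> = (\<Sum>c\<le>m. (w c)\<^sup>2 * w m)"
    by (subst sum.reindex) (auto simp: inj_on_def)
  also have "\<dots> = (\<Sum>c\<le>m. (w c)\<^sup>2) * w m"
    by (simp add: sum_distrib_right)
  also have "(\<Sum>c\<le>m. (w c)\<^sup>2) = W\<^sup>2"
    unfolding W_def by (induction m) (simp_all add: poly2_square_add)
  finally have "W * total_Sq (w m) = W * (W * w m)"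
    by (simp add: power2_eq_square mult_ac)
  moreover have "W \<noteq> 0" using W0 by (auto simp: W_def)
  ultimately show total_Sq: "total_Sq (w m) = (\<Sum>i\<le>m. w i) * w m" by (simp add: W_def)
  \<comment> \<open>Since \<open>w i\<close> is homogeneous of degree \<open>i\<close>, the
    component of \<open>total_Sq (w m) = W * w m\<close> in degree \<open>m + i\<close> yields the
    individual squares.\<close>
  have "hpart i W = w i"
    using w(3)[of i] by (auto simp: W_def hpart_sum hpart_homog[OF w(1)])
  then show "Hstar_Sq i (w m) = w i * w m"
    using hpart_homog_mult[OF w(1), of m "m + i" W]
    by (simp add: Hstar_Sq_homog[OF w(1)] total_Sq W_def mult.commute)
qed

section \<open>Modules with one-dimensional reduction\<close>

context unstable_HV_A_module
begin

interpretation E: module "Hstar V" E by (rule Hstar_module)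

interpretation U: unstable_A_module "underlying_A_module E" by (rule A_module)

section \<open>The underlying module over the Steenrod algebra\<close>

lemma underlying_simps:
  "carrier (underlying_A_module E) = carrier E"
  "x \<oplus>\<^bsub>underlying_A_module E\<^esub> y = x \<oplus>\<^bsub>E\<^esub> y"
  "\<zero>\<^bsub>underlying_A_module E\<^esub> = \<zero>\<^bsub>E\<^esub>"
  "c \<odot>\<^bsub>underlying_A_module E\<^esub> x = Poly_Mapping.single 0 c \<odot>\<^bsub>E\<^esub> x"
  "gr (underlying_A_module E) = gr E" "Sq (underlying_A_module E) = Sq E"
  by (simp_all add: underlying_A_module_def)

lemma underlying_finsum: "finsum (underlying_A_module E) f A = finsum E f A"
  by (simp add: finsum_def finprod_def underlying_A_module_def)

lemma gr_carrier: "x \<in> gr E k \<Longrightarrow> x \<in> carrier E"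
  using U.submoduleE(1)[OF U.gr_submodule[of k]] by (auto simp: underlying_simps)

lemma gr_add: "x \<in> gr E k \<Longrightarrow> y \<in> gr E k \<Longrightarrow> x \<oplus>\<^bsub>E\<^esub> y \<in> gr E k"
  using U.submoduleE(5)[OF U.gr_submodule[of k]] by (simp add: underlying_simps)

lemma gr_zero: "\<zero>\<^bsub>E\<^esub> \<in> gr E k"
  using subgroup.one_closed[OF submodule.axioms(1)[OF U.gr_submodule[of k]]]
  by (simp add: underlying_simps)

text \<open>In negative degrees instability also kills the square of index 0, which is the
  identity.\<close>

lemma gr_neg: "x \<in> gr E k \<Longrightarrow> k < 0 \<Longrightarrow> x = \<zero>\<^bsub>E\<^esub>"
  using U.unstable[of x k 0] U.Sq_0[of x] gr_carrier[of x k] by (simp add: underlying_simps)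

lemma Sq_gr: "x \<in> gr E k \<Longrightarrow> Sq E i x \<in> gr E (k + int i)"
  using U.Sq_gr[of x k i] by (simp add: underlying_simps)

section \<open>Homogeneous components\<close>

definition decomp :: "'a \<Rightarrow> (int \<Rightarrow> 'a) \<Rightarrow> bool" where
  "decomp x f \<longleftrightarrow> (\<forall>k. f k \<in> gr E k) \<and> finite {k. f k \<noteq> \<zero>\<^bsub>E\<^esub>} \<and>
     x = (\<Oplus>\<^bsub>E\<^esub> k \<in> {k. f k \<noteq> \<zero>\<^bsub>E\<^esub>}. f k)"

definition component :: "'a \<Rightarrow> int \<Rightarrow> 'a" where
  "component x = (THE f. decomp x f)"

lemma decomp_ex1: "x \<in> carrier E \<Longrightarrow> \<exists>!f. decomp x f"
  unfolding decomp_def using U.gr_direct_sum[of x] by (simp add: underlying_simps underlying_finsum)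

lemma decomp_component: "x \<in> carrier E \<Longrightarrow> decomp x (component x)"
  unfolding component_def by (rule theI'[OF decomp_ex1])

lemma component_eqI: "x \<in> carrier E \<Longrightarrow> decomp x f \<Longrightarrow> component x = f"
  unfolding component_def by (rule the1_equality[OF decomp_ex1])

text \<open>Allows the components of several elements to be summed over one common finite index
  set.\<close>

lemma decomp_superset:
  assumes f: "\<And>k. f k \<in> gr E k" and A: "finite A" "{k. f k \<noteq> \<zero>\<^bsub>E\<^esub>} \<subseteq> A"
  shows "decomp x f \<longleftrightarrow> x = finsum E f A"
proof -
  have "finsum E f {k. f k \<noteq> \<zero>\<^bsub>E\<^esub>} = finsum E f A"
    by (rule E.M.add.finprod_mono_neutral_cong_left) (use A f gr_carrier in auto)
  then show ?thesis using f A finite_subset unfolding decomp_def by auto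
qed

lemma component_gr: "x \<in> carrier E \<Longrightarrow> component x k \<in> gr E k"
  using decomp_component by (auto simp: decomp_def)

lemma component_homogeneous:
  assumes "x \<in> gr E k" shows "component x j = (if j = k then x else \<zero>\<^bsub>E\<^esub>)"
proof -
  have "decomp x (\<lambda>j. if j = k then x else \<zero>\<^bsub>E\<^esub>)"
    using assms gr_carrier[OF assms]
    by (subst decomp_superset[of _ "{k}"]) (auto simp: gr_zero)
  then show ?thesis using component_eqI[OF gr_carrier[OF assms]] by simp
qed

lemma component_zero: "component \<zero>\<^bsub>E\<^esub> j = \<zero>\<^bsub>E\<^esub>"
  using component_homogeneous[OF gr_zero] by metis

lemma component_add:
  assumes x: "x \<in> carrier E" and y: "y \<in> carrier E"
  shows "component (x \<oplus>\<^bsub>E\<^esub> y) j = component x j \<oplus>\<^bsub>E\<^esub> component y j"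
proof -
  let ?A = "{k. component x k \<noteq> \<zero>\<^bsub>E\<^esub>} \<union> {k. component y k \<noteq> \<zero>\<^bsub>E\<^esub>}"
  have A: "finite ?A" using decomp_component[OF x] decomp_component[OF y] by (simp add: decomp_def)
  have "x = finsum E (component x) ?A" "y = finsum E (component y) ?A"
    using decomp_component[OF x] decomp_component[OF y] decomp_superset[OF _ A] component_gr x y by blast+
  then have "x \<oplus>\<^bsub>E\<^esub> y = finsum E (component x) ?A \<oplus>\<^bsub>E\<^esub> finsum E (component y) ?A" by simp
  also have "\<dots> = finsum E (\<lambda>k. component x k \<oplus>\<^bsub>E\<^esub> component y k) ?A"
    by (rule E.M.finsum_addf[symmetric]) (use component_gr gr_carrier x y in blast)+
  finally have "decomp (x \<oplus>\<^bsub>E\<^esub> y) (\<lambda>k. component x k \<oplus>\<^bsub>E\<^esub> component y k)"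
    by (subst decomp_superset[OF _ A]) (use component_gr gr_add x y in auto)
  then show ?thesis using component_eqI[of "x \<oplus>\<^bsub>E\<^esub> y"] x y by simp
qed

lemma homogeneous_induct [consumes 1, case_names zero gr add]:
  assumes "x \<in> carrier E" "P \<zero>\<^bsub>E\<^esub>" "\<And>k y. y \<in> gr E k \<Longrightarrow> P y"
    "\<And>y z. y \<in> carrier E \<Longrightarrow> z \<in> carrier E \<Longrightarrow> P y \<Longrightarrow> P z \<Longrightarrow> P (y \<oplus>\<^bsub>E\<^esub> z)"
  shows "P x"
proof -
  have "P (finsum E (component x) A)" if "finite A" for A
    using that
  proof induction
    case (insert k A)
    have c: "component x k \<in> carrier E" for k using component_gr[OF assms(1)] gr_carrier by blast
    then have "finsum E (component x) (insert k A) = component x k \<oplus>\<^bsub>E\<^esub> finsum E (component x) A"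
      using insert by (intro E.M.finsum_insert) auto
    then show ?case
      using insert c assms(3)[OF component_gr[OF assms(1)]] by (simp add: assms(4) E.M.finsum_closed)
  qed (simp add: assms)
  then show ?thesis using decomp_component[OF assms(1)] unfolding decomp_def by metis
qed

lemma smult_gr_nat:
  "h \<in> Pol (rank V) \<Longrightarrow> homog k h \<Longrightarrow> x \<in> gr E j \<Longrightarrow> h \<odot>\<^bsub>E\<^esub> x \<in> gr E (int k + j)"
  by (rule smult_gr) (simp_all add: Hstar_gr_nat)

lemma component_smult_homogeneous:
  assumes x: "x \<in> carrier E" and h: "h \<in> Pol (rank V)" "homog k h"
  shows "component (h \<odot>\<^bsub>E\<^esub> x) j = h \<odot>\<^bsub>E\<^esub> component x (j - int k)"
  using x
proof (induction rule: homogeneous_induct)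
  case zero
  then show ?case using h by (simp add: component_zero carrier_Hstar)
next
  case (gr l y)
  then show ?case
    using component_homogeneous[OF smult_gr_nat[OF h gr]] h by (auto simp: component_homogeneous carrier_Hstar)
next
  case (add y z)
  moreover have "component y i \<in> carrier E" "component z i \<in> carrier E" for i
    using add.hyps component_gr gr_carrier by blast+
  ultimately show ?case
    using h by (simp add: E.smult_r_distr component_add carrier_Hstar)
qed

text \<open>Only the part of \<open>h\<close> in degree \<open>j - n\<close> reaches degree
  \<open>j\<close>. For \<open>j < n\<close> the truncation by \<open>nat\<close> would pick out
  degree zero, so this range needs its own case.\<close>

lemma component_smult_generator:
  assumes e: "e \<in> gr E (int n)" and h: "h \<in> Pol (rank V)"
  shows "component (h \<odot>\<^bsub>E\<^esub> e) j = (if int n \<le> j then hpart (nat (j - int n)) h \<odot>\<^bsub>E\<^esub> e else \<zero>\<^bsub>E\<^esub>)"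
proof -
  have "keys h \<subseteq> {m. keys m \<subseteq> {..<rank V}}" using h by (auto simp: Pol_def)
  then show ?thesis
  proof (induction h rule: poly2_set_induct)
    case zero
    then show ?case using gr_carrier[OF e] E.smult_l_null[of e] by (simp add: component_zero)
  next
    case (mon m)
    then have "mon m \<in> Pol (rank V)" by (simp add: Pol_def)
    moreover have "\<zero>\<^bsub>Hstar V\<^esub> \<odot>\<^bsub>E\<^esub> e = \<zero>\<^bsub>E\<^esub>" using gr_carrier[OF e] by (rule E.smult_l_null)
    ultimately show ?case
      using component_smult_homogeneous[OF gr_carrier[OF e], of "mon m" "mdeg m" j]
      by (auto simp: component_homogeneous[OF e] hpart_mon carrier_Hstar)
  next
    case (add p q)
    then have pq: "p \<in> Pol (rank V)" "q \<in> Pol (rank V)" by (auto simp: Pol_def)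
    have "(p + q) \<odot>\<^bsub>E\<^esub> e = p \<odot>\<^bsub>E\<^esub> e \<oplus>\<^bsub>E\<^esub> q \<odot>\<^bsub>E\<^esub> e" if "p \<in> Pol (rank V)" "q \<in> Pol (rank V)" for p q
      using E.smult_l_distr[of p q e] that gr_carrier[OF e] by (simp add: carrier_Hstar)
    then show ?case
      using add pq gr_carrier[OF e] by (simp add: component_add carrier_Hstar hpart_add hpart_Pol)
  qed
qed

text \<open>Multiplication by \<open>h\<close> multiplies all coordinates in a basis by
  \<open>h\<close>. The coordinates of zero are unique, and the polynomial ring has no zero
  divisors.\<close>

lemma free_imp_torsion_free:
  assumes free: "free_module (Hstar V) E"
    and x: "x \<in> carrier E" and h: "h \<in> Pol (rank V)" "h \<noteq> 0" and hx: "h \<odot>\<^bsub>E\<^esub> x = \<zero>\<^bsub>E\<^esub>"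
  shows "x = \<zero>\<^bsub>E\<^esub>"
proof -
  define rep where "rep B x c \<longleftrightarrow>
      (\<forall>b\<in>B. c b \<in> Pol (rank V)) \<and> (\<forall>b. b \<notin> B \<longrightarrow> c b = 0) \<and> finite {b. c b \<noteq> 0} \<and>
      x = (\<Oplus>\<^bsub>E\<^esub> b \<in> {b. c b \<noteq> 0}. c b \<odot>\<^bsub>E\<^esub> b)" for B x c
  have "\<exists>B\<subseteq>carrier E. \<forall>x\<in>carrier E. \<exists>!c. rep B x c"
    using free by (simp only: free_module_def rep_def carrier_Hstar Hstar_ops)
  then obtain B where B: "B \<subseteq> carrier E" and ex1: "\<And>x. x \<in> carrier E \<Longrightarrow> \<exists>!c. rep B x c"
    by (elim exE conjE) (rule that, assumption, drule bspec)
  obtain c where "rep B x c" using ex1[OF x] by blast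
  then have c: "\<And>b. b \<in> B \<Longrightarrow> c b \<in> Pol (rank V)" "\<And>b. b \<notin> B \<Longrightarrow> c b = 0" "finite {b. c b \<noteq> 0}"
      "x = (\<Oplus>\<^bsub>E\<^esub> b \<in> {b. c b \<noteq> 0}. c b \<odot>\<^bsub>E\<^esub> b)"
    by (simp_all add: rep_def)
  have inB: "c b \<in> Pol (rank V)" "b \<in> carrier E" if "c b \<noteq> 0" for b using c(1,2) B that by blast+
  have "h \<odot>\<^bsub>E\<^esub> x = (\<Oplus>\<^bsub>E\<^esub> b \<in> {b. c b \<noteq> 0}. h \<odot>\<^bsub>E\<^esub> (c b \<odot>\<^bsub>E\<^esub> b))"
    unfolding c(4) using c(3) h inB
    by (intro E.finsum_smult_ldistr) (auto simp: carrier_Hstar)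
  also have "\<dots> = (\<Oplus>\<^bsub>E\<^esub> b \<in> {b. c b \<noteq> 0}. (h * c b) \<odot>\<^bsub>E\<^esub> b)"
  proof (rule E.M.finsum_cong')
    show "h \<odot>\<^bsub>E\<^esub> (c b \<odot>\<^bsub>E\<^esub> b) = (h * c b) \<odot>\<^bsub>E\<^esub> b" if "b \<in> {b. c b \<noteq> 0}" for b
      using E.smult_assoc1[of h "c b" b] h inB that by (auto simp: carrier_Hstar)
  qed (use h inB in \<open>auto simp: carrier_Hstar Pol_mult\<close>)
  \<comment> \<open>As \<open>h \<noteq> 0\<close>, \<open>h * c b\<close> vanishes exactly when
    \<open>c b\<close> does, so the sum already runs over the right support.\<close>
  finally have "rep B \<zero>\<^bsub>E\<^esub> (\<lambda>b. h * c b)"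
    using hx h c by (simp add: rep_def Pol_mult)
  moreover have "rep B \<zero>\<^bsub>E\<^esub> (\<lambda>b. 0)" by (simp add: rep_def)
  ultimately have "(\<lambda>b. h * c b) = (\<lambda>b. 0)" using ex1[OF E.M.zero_closed] by blast
  then have "h * c b = 0" for b by (rule fun_cong)
  then have "c b = 0" for b using h by simp
  then show ?thesis using c(4) by simp
qed

section \<open>Decomposable elements and the graded Nakayama lemma\<close>

abbreviation decomposables :: "'a set" where
  "decomposables \<equiv> generate (add_monoid E)
     {h \<odot>\<^bsub>E\<^esub> x | h x. h \<in> augmentation_ideal V \<and> x \<in> carrier E}"

lemma augmentation_ideal_Pol: "h \<in> augmentation_ideal V \<Longrightarrow> h \<in> Pol (rank V)"
  by (simp add: augmentation_ideal_def carrier_Hstar)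

lemma double_zero: "x \<in> carrier E \<Longrightarrow> x \<oplus>\<^bsub>E\<^esub> x = \<zero>\<^bsub>E\<^esub>"
  using E.smult_l_distr[of 1 1 x] E.smult_one[of x] E.smult_l_null[of x]
  by (simp add: carrier_Hstar)

lemma a_inv_eq: "x \<in> carrier E \<Longrightarrow> \<ominus>\<^bsub>E\<^esub> x = x"
  using double_zero E.M.minus_equality by blast

lemma decomposables_subgroup: "abelian_subgroup decomposables E"
proof (rule abelian_subgroupI3)
  have "subgroup decomposables (add_monoid E)"
    by (rule E.M.add.generate_is_subgroup) (auto simp: augmentation_ideal_Pol carrier_Hstar)
  then show "additive_subgroup decomposables E" by (rule additive_subgroup.intro)
qed (rule E.M.abelian_group_axioms)

text \<open>Let \<open>F k\<close> consist of the elements without components below degree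
  \<open>k\<close>. By induction on \<open>k\<close>, every element is a multiple of
  \<open>e\<close> modulo \<open>F k\<close>: nothing lives in negative degrees, and the
  augmentation ideal raises the filtration by one. For a homogeneous element a large
  \<open>k\<close> leaves no remainder in its degree.\<close>

lemma graded_Nakayama:
  assumes e: "e \<in> gr E (int n)"
    and span: "\<And>x. x \<in> carrier E \<Longrightarrow> x \<in> decomposables \<or> (\<exists>z\<in>decomposables. x = z \<oplus>\<^bsub>E\<^esub> e)"
    and x: "x \<in> carrier E"
  shows "\<exists>h\<in>Pol (rank V). x = h \<odot>\<^bsub>E\<^esub> e"
proof -
  note e' = gr_carrier[OF e]
  define F where "F k = {x \<in> carrier E. \<forall>j<int k. component x j = \<zero>\<^bsub>E\<^esub>}" for k
  define G where "G k = {h \<odot>\<^bsub>E\<^esub> e \<oplus>\<^bsub>E\<^esub> y | h y. h \<in> Pol (rank V) \<and> y \<in> F k}" for k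
  have F_add: "x \<oplus>\<^bsub>E\<^esub> y \<in> F k" if "x \<in> F k" "y \<in> F k" for x y k
    using that by (auto simp: F_def component_add)
  have F_0: "\<zero>\<^bsub>E\<^esub> \<in> F k" for k by (simp add: F_def component_zero)
  have F_smult: "h \<odot>\<^bsub>E\<^esub> y \<in> F (Suc k)" if h: "h \<in> augmentation_ideal V" and y: "y \<in> F k" for h y k
  proof -
    have y': "y \<in> carrier E" using y by (simp add: F_def)
    \<comment> \<open>Without a constant term, each monomial of \<open>h\<close> raises degrees by
      at least one.\<close>
    have "keys h \<subseteq> {m. keys m \<subseteq> {..<rank V} \<and> m \<noteq> 0}"
      using h by (auto simp: augmentation_ideal_def carrier_Hstar Pol_def in_keys_iff)
    then show ?thesis
    proof (induction h rule: poly2_set_induct)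
      case zero
      then show ?case using E.smult_l_null[OF y'] F_0 by simp
    next
      case (mon m)
      then have m: "mon m \<in> Pol (rank V)" "mdeg m \<noteq> 0" by (simp_all add: Pol_def mdeg_eq_0_iff)
      then show ?case
        using y y' component_smult_homogeneous[OF y' m(1), of "mdeg m"]
        by (auto simp: F_def carrier_Hstar)
    next
      case (add p q)
      then have pq: "p \<in> Pol (rank V)" "q \<in> Pol (rank V)" by (auto simp: Pol_def)
      then have "(p + q) \<odot>\<^bsub>E\<^esub> y = p \<odot>\<^bsub>E\<^esub> y \<oplus>\<^bsub>E\<^esub> q \<odot>\<^bsub>E\<^esub> y"
        using E.smult_l_distr[of p q y] y' by (simp add: carrier_Hstar)
      then show ?case using add F_add by simp
    qed
  qed
  have G_carrier: "G k \<subseteq> carrier E" for k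
    using e' by (auto simp: G_def F_def carrier_Hstar)
  have G_add: "x \<oplus>\<^bsub>E\<^esub> y \<in> G k" if xy: "x \<in> G k" "y \<in> G k" for x y k
  proof -
    obtain h a where x: "x = h \<odot>\<^bsub>E\<^esub> e \<oplus>\<^bsub>E\<^esub> a" "h \<in> Pol (rank V)" "a \<in> F k"
      using xy by (auto simp: G_def)
    obtain g b where y: "y = g \<odot>\<^bsub>E\<^esub> e \<oplus>\<^bsub>E\<^esub> b" "g \<in> Pol (rank V)" "b \<in> F k"
      using xy by (auto simp: G_def)
    have car: "a \<in> carrier E" "b \<in> carrier E" "h \<odot>\<^bsub>E\<^esub> e \<in> carrier E" "g \<odot>\<^bsub>E\<^esub> e \<in> carrier E"
      using x y e' by (auto simp: F_def carrier_Hstar)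
    have "(h + g) \<odot>\<^bsub>E\<^esub> e = h \<odot>\<^bsub>E\<^esub> e \<oplus>\<^bsub>E\<^esub> g \<odot>\<^bsub>E\<^esub> e"
      using E.smult_l_distr[of h g e] x y e' by (simp add: carrier_Hstar)
    then have "x \<oplus>\<^bsub>E\<^esub> y = (h + g) \<odot>\<^bsub>E\<^esub> e \<oplus>\<^bsub>E\<^esub> (a \<oplus>\<^bsub>E\<^esub> b)"
      using car by (simp add: x(1) y(1) E.M.a_ac)
    then show ?thesis using F_add[of a k b] x y Pol_add unfolding G_def by blast
  qed
  have decomposables_G: "decomposables \<subseteq> G (Suc k)" if G: "carrier E \<subseteq> G k" for k
  proof
    have gen: "h \<odot>\<^bsub>E\<^esub> x \<in> G (Suc k)" if h: "h \<in> augmentation_ideal V" and x: "x \<in> carrier E" for h x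
    proof -
      obtain g y where x: "x = g \<odot>\<^bsub>E\<^esub> e \<oplus>\<^bsub>E\<^esub> y" and g: "g \<in> Pol (rank V)" and y: "y \<in> F k"
        using G x by (auto simp: G_def)
      have "h \<odot>\<^bsub>E\<^esub> x = (h * g) \<odot>\<^bsub>E\<^esub> e \<oplus>\<^bsub>E\<^esub> h \<odot>\<^bsub>E\<^esub> y"
        using E.smult_r_distr[of h "g \<odot>\<^bsub>E\<^esub> e" y] E.smult_assoc1[of h g e] augmentation_ideal_Pol[OF h] g e' y
        by (simp add: x carrier_Hstar F_def)
      then show ?thesis
        using F_smult[OF h y] Pol_mult[OF augmentation_ideal_Pol[OF h] g] unfolding G_def by blast
    qed
    fix z assume "z \<in> decomposables"
    then show "z \<in> G (Suc k)"
    proof induction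
      case one
      have "0 \<odot>\<^bsub>E\<^esub> e \<oplus>\<^bsub>E\<^esub> \<zero>\<^bsub>E\<^esub> \<in> G (Suc k)" unfolding G_def using F_0 Pol_0 Pol_1 by blast
      then show ?case using E.smult_l_null[OF e'] by simp
    next
      case (incl z)
      then show ?case using gen by auto
    next
      case (inv z)
      then obtain h x where "z = h \<odot>\<^bsub>E\<^esub> x" "h \<in> augmentation_ideal V" "x \<in> carrier E" by auto
      moreover from this have "inv\<^bsub>add_monoid E\<^esub> z = z"
        using a_inv_eq[of z] augmentation_ideal_Pol by (simp add: a_inv_def carrier_Hstar)
      ultimately show ?case using gen by simp
    next
      case (eng y z)
      then show ?case using G_add by simp
    qed
  qed
  have G: "carrier E \<subseteq> G k" for k
  proof (induction k)
    case 0
    have "\<zero>\<^bsub>E\<^esub> = component x j" if "x \<in> carrier E" "j < 0" for x j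
      using gr_neg[OF component_gr[OF that(1)] that(2)] by simp
    then have "x \<in> F 0" if "x \<in> carrier E" for x using that by (simp add: F_def)
    then have "0 \<odot>\<^bsub>E\<^esub> e \<oplus>\<^bsub>E\<^esub> x \<in> G 0" if "x \<in> carrier E" for x unfolding G_def using that Pol_0 by blast
    then show ?case using E.smult_l_null[OF e'] by auto
  next
    case (Suc k)
    have "1 \<odot>\<^bsub>E\<^esub> e \<oplus>\<^bsub>E\<^esub> \<zero>\<^bsub>E\<^esub> \<in> G (Suc k)" unfolding G_def using F_0 Pol_0 Pol_1 by blast
    then have "e \<in> G (Suc k)" using E.smult_one[OF e'] e' by simp
    then show ?case
      using span decomposables_G[OF Suc] G_add by blast
  qed
  from x show ?thesis
  proof (induction rule: homogeneous_induct)
    case zero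
    show ?case using E.smult_l_null[OF e'] by (intro bexI[of _ 0]) simp_all
  next
    case (gr j x)
    \<comment> \<open>One more than the degree, so that taking components in degree \<open>j\<close>
      removes the remainder \<open>y\<close>.\<close>
    define k where "k = Suc (nat j)"
    obtain h y where x: "x = h \<odot>\<^bsub>E\<^esub> e \<oplus>\<^bsub>E\<^esub> y" "h \<in> Pol (rank V)" "y \<in> F k"
      using G gr_carrier[OF gr] unfolding G_def by blast
    have "component y j = \<zero>\<^bsub>E\<^esub>" using x(3) by (simp add: F_def k_def)
    moreover have "component x j = component (h \<odot>\<^bsub>E\<^esub> e) j \<oplus>\<^bsub>E\<^esub> component y j"
      unfolding x(1) using x e' by (intro component_add) (auto simp: F_def carrier_Hstar)
    moreover have "component (h \<odot>\<^bsub>E\<^esub> e) j \<in> carrier E"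
      using component_gr[of "h \<odot>\<^bsub>E\<^esub> e"] gr_carrier x e' by (auto simp: carrier_Hstar)
    ultimately have "x = component (h \<odot>\<^bsub>E\<^esub> e) j" using component_homogeneous[OF gr, of j] by simp
    then have "x = hpart (nat (j - int n)) h \<odot>\<^bsub>E\<^esub> e \<or> x = 0 \<odot>\<^bsub>E\<^esub> e"
      unfolding component_smult_generator[OF e x(2)] using E.smult_l_null[OF e'] by (auto split: if_splits)
    then show ?case using hpart_Pol[OF x(2)] Pol_0 by blast
  next
    case (add y z)
    then obtain h g where "h \<in> Pol (rank V)" "g \<in> Pol (rank V)" "y = h \<odot>\<^bsub>E\<^esub> e" "z = g \<odot>\<^bsub>E\<^esub> e" by auto
    then show ?case
      using E.smult_l_distr[of h g e] e' Pol_add by (intro bexI[of _ "h + g"]) (auto simp: carrier_Hstar)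
  qed
qed

text \<open>Composed with the quotient map, the isomorphism becomes an additive map \<open>f\<close>
  to the two-element field whose fibres are the cosets of \<open>decomposables\<close> and which
  vanishes on homogeneous elements outside degree \<open>n\<close>. A homogeneous element with value
  1 serves as \<open>e\<close>.\<close>

lemma reduction_generator:
  assumes "sq_iso F2 (reduction V E) (suspension n F2_module)"
  obtains e where "e \<in> gr E (int n)" "e \<noteq> \<zero>\<^bsub>E\<^esub>"
    "\<And>x. x \<in> carrier E \<Longrightarrow> x \<in> decomposables \<or> (\<exists>z\<in>decomposables. x = z \<oplus>\<^bsub>E\<^esub> e)"
proof -
  let ?N = decomposables and ?Q = "reduction V E"
  interpret N: abelian_subgroup ?N E by (rule decomposables_subgroup)
  have coset: "?N +>\<^bsub>underlying_A_module E\<^esub> x = ?N +>\<^bsub>E\<^esub> x" for x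
    by (simp add: a_r_coset_def' underlying_simps)
  have Q: "carrier ?Q = a_rcosets\<^bsub>E\<^esub> ?N" "C \<oplus>\<^bsub>?Q\<^esub> D = C <+>\<^bsub>E\<^esub> D"
      "gr ?Q k = (\<lambda>x. ?N +>\<^bsub>E\<^esub> x) ` gr E k" for C D k
    by (simp_all add: reduction_def quotient_module_def A_RCOSETS_def' coset underlying_simps set_add_def set_mult_def)
  have S: "carrier (suspension n F2_module) = UNIV" "b \<oplus>\<^bsub>suspension n F2_module\<^esub> c = b + c"
      "gr (suspension n F2_module) k = (if k = int n then UNIV else {0})" for b c k
    by (simp_all add: suspension_def F2_module_def)
  obtain \<phi> :: "'a set \<Rightarrow> bit" where "bij_betw \<phi> (carrier ?Q) UNIV"
      "\<forall>C\<in>carrier ?Q. \<forall>D\<in>carrier ?Q. \<phi> (C \<oplus>\<^bsub>?Q\<^esub> D) = \<phi> C + \<phi> D"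
      "\<forall>k. \<forall>C\<in>gr ?Q k. \<phi> C \<in> (if k = int n then UNIV else {0})"
    using assms unfolding sq_iso_def S by blast
  then have \<phi>: "bij_betw \<phi> (carrier ?Q) UNIV"
      "\<And>C D. C \<in> carrier ?Q \<Longrightarrow> D \<in> carrier ?Q \<Longrightarrow> \<phi> (C \<oplus>\<^bsub>?Q\<^esub> D) = \<phi> C + \<phi> D"
      "\<And>k C. C \<in> gr ?Q k \<Longrightarrow> \<phi> C \<in> (if k = int n then UNIV else {0})"
    by (simp_all del: add_bit_eq_xor)
  define f where "f x = \<phi> (?N +>\<^bsub>E\<^esub> x)" for x
  have cos: "?N +>\<^bsub>E\<^esub> x \<in> carrier ?Q" if "x \<in> carrier E" for x
    unfolding Q using that by (intro E.M.a_rcosetsI N.a_subset)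
  have f_add: "f (x \<oplus>\<^bsub>E\<^esub> y) = f x + f y" if "x \<in> carrier E" "y \<in> carrier E" for x y
    using \<phi>(2)[OF cos[OF that(1)] cos[OF that(2)]] unfolding f_def Q(2) N.a_rcos_sum[OF that] .
  have f_gr: "f x = 0" if "x \<in> gr E k" "k \<noteq> int n" for x k
    using \<phi>(3)[of "?N +>\<^bsub>E\<^esub> x" k] that by (auto simp: f_def Q)
  \<comment> \<open>Zero lies in every degree, in particular in one other than
    \<open>n\<close>.\<close>
  have f0: "f \<zero>\<^bsub>E\<^esub> = 0" using f_gr[OF gr_zero[of "int n + 1"]] by simp
  have f_eq: "\<exists>z\<in>?N. x = z \<oplus>\<^bsub>E\<^esub> y" if "x \<in> carrier E" "y \<in> carrier E" "f x = f y" for x y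
  proof -
    have "?N +>\<^bsub>E\<^esub> x = ?N +>\<^bsub>E\<^esub> y"
      using inj_onD[OF bij_betw_imp_inj_on[OF \<phi>(1)] _ cos[OF that(1)] cos[OF that(2)]] that(3)
      by (simp add: f_def)
    then have "x \<in> ?N +>\<^bsub>E\<^esub> y" using N.a_rcos_self[OF that(1)] by simp
    then show ?thesis by (auto simp: a_r_coset_def')
  qed
  obtain y where y: "y \<in> carrier E" "f y = 1"
  proof -
    obtain C where "C \<in> carrier ?Q" "\<phi> C = 1" using \<phi>(1) by (metis UNIV_I bij_betw_imp_surj_on imageE)
    then show ?thesis using that by (auto simp: Q A_RCOSETS_def' f_def)
  qed
  \<comment> \<open>If \<open>f\<close> vanished on all of degree \<open>n\<close>, it would vanish
    on every sum of homogeneous elements, hence on \<open>y\<close>.\<close>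
  have "(\<exists>e\<in>gr E (int n). f e = 1) \<or> f y = 0"
    using y(1)
  proof (induction rule: homogeneous_induct)
    case (gr k x)
    then show ?case using f_gr[of x k] by (cases "k = int n"; cases "f x") auto
  qed (auto simp: f0 f_add)
  then obtain e where e: "e \<in> gr E (int n)" "f e = 1" using y by auto
  show ?thesis
  proof (rule that[OF e(1)])
    show "e \<noteq> \<zero>\<^bsub>E\<^esub>" using e f0 by auto
    fix x assume x: "x \<in> carrier E"
    show "x \<in> ?N \<or> (\<exists>z\<in>?N. x = z \<oplus>\<^bsub>E\<^esub> e)"
    proof (cases "f x")
      case zero
      then obtain z where "z \<in> ?N" "x = z \<oplus>\<^bsub>E\<^esub> \<zero>\<^bsub>E\<^esub>" using f_eq[OF x E.M.zero_closed] f0 by auto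
      then show ?thesis using N.a_subset by auto
    next
      case one
      then show ?thesis using f_eq[OF x gr_carrier[OF e(1)]] e by auto
    qed
  qed
qed

section \<open>Structure of a free module on one generator\<close>

lemma finsum_smult_generator:
  assumes "e \<in> carrier E" "\<And>i. i \<in> A \<Longrightarrow> h i \<in> Pol (rank V)" "finite A"
  shows "(\<Oplus>\<^bsub>E\<^esub> i \<in> A. h i \<odot>\<^bsub>E\<^esub> e) = (\<Sum>i\<in>A. h i) \<odot>\<^bsub>E\<^esub> e"
  using assms(3,2)
proof induction
  case empty
  show ?case using E.smult_l_null[OF assms(1)] by simp
next
  case (insert i A)
  then have "(\<Oplus>\<^bsub>E\<^esub> i \<in> insert i A. h i \<odot>\<^bsub>E\<^esub> e) = h i \<odot>\<^bsub>E\<^esub> e \<oplus>\<^bsub>E\<^esub> (\<Oplus>\<^bsub>E\<^esub> i \<in> A. h i \<odot>\<^bsub>E\<^esub> e)"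
    using assms(1) by (intro E.M.finsum_insert) (auto simp: carrier_Hstar)
  then show ?case
    using insert E.smult_l_distr[of "h i" "sum h A" e] assms(1) Pol_sum[of A h]
    by (simp add: carrier_Hstar)
qed

text \<open>Freeness enters through torsion-freeness: multiples of \<open>e\<close> have unique
  coefficients, so elements and Steenrod squares are computed in terms of
  \<open>coord\<close>.\<close>

lemma product_of_linear_forms:
  assumes free: "free_module (Hstar V) E"
    and e: "e \<in> gr E (int n)" "e \<noteq> \<zero>\<^bsub>E\<^esub>"
    and gen: "\<And>x. x \<in> carrier E \<Longrightarrow> \<exists>h\<in>Pol (rank V). x = h \<odot>\<^bsub>E\<^esub> e"
  shows "\<exists>d ts. set ts \<subseteq> linear_forms (rank V) - {0} \<and> d + length ts = n \<and>
    sq_iso (Hstar V) E (suspension d (principal_ideal_module V (prod_list ts)))"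
proof -
  let ?P = "Pol (rank V)"
  note e' = gr_carrier[OF e(1)]
  have smult_add: "(h + g) \<odot>\<^bsub>E\<^esub> e = h \<odot>\<^bsub>E\<^esub> e \<oplus>\<^bsub>E\<^esub> g \<odot>\<^bsub>E\<^esub> e" if "h \<in> ?P" "g \<in> ?P" for h g
    using E.smult_l_distr[of h g e] that e' by (simp add: carrier_Hstar)
  have smult_mult: "(h * g) \<odot>\<^bsub>E\<^esub> e = h \<odot>\<^bsub>E\<^esub> (g \<odot>\<^bsub>E\<^esub> e)" if "h \<in> ?P" "g \<in> ?P" for h g
    using E.smult_assoc1[of h g e] that e' by (simp add: carrier_Hstar)
  have smult_zero: "0 \<odot>\<^bsub>E\<^esub> e = \<zero>\<^bsub>E\<^esub>" using E.smult_l_null[OF e'] by simp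
  have inj: "h = g" if "h \<in> ?P" "g \<in> ?P" "h \<odot>\<^bsub>E\<^esub> e = g \<odot>\<^bsub>E\<^esub> e" for h g
  proof -
    have "(h + g) \<odot>\<^bsub>E\<^esub> e = \<zero>\<^bsub>E\<^esub>"
      using that e' double_zero[of "g \<odot>\<^bsub>E\<^esub> e"] by (simp add: smult_add carrier_Hstar)
    then have "h + g = 0" using free_imp_torsion_free[OF free e'] that e(2) Pol_add by blast
    then show ?thesis using poly2_eq_iff_add by simp
  qed
  define coord where "coord x = (THE h. h \<in> ?P \<and> x = h \<odot>\<^bsub>E\<^esub> e)" for x
  have coord: "coord x \<in> ?P \<and> x = coord x \<odot>\<^bsub>E\<^esub> e" if "x \<in> carrier E" for x
    unfolding coord_def by (rule theI') (use gen[OF that] inj in blast)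
  have coord_smult: "coord (h \<odot>\<^bsub>E\<^esub> e) = h" if "h \<in> ?P" for h
    using coord[of "h \<odot>\<^bsub>E\<^esub> e"] inj[of h "coord (h \<odot>\<^bsub>E\<^esub> e)"] that e' by (simp add: carrier_Hstar)
  have coord_gr: "if int n \<le> j then homog (nat (j - int n)) (coord x) else coord x = 0" if "x \<in> gr E j" for x j
  proof -
    have x: "x \<in> carrier E" using gr_carrier that .
    have "x = component (coord x \<odot>\<^bsub>E\<^esub> e) j" using component_homogeneous[OF that, of j] coord[OF x] by simp
    then have "coord x \<odot>\<^bsub>E\<^esub> e = (if int n \<le> j then hpart (nat (j - int n)) (coord x) else 0) \<odot>\<^bsub>E\<^esub> e"
      using component_smult_generator[OF e(1), of "coord x" j] coord[OF x] smult_zero by auto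
    then have "coord x = (if int n \<le> j then hpart (nat (j - int n)) (coord x) else 0)"
      using coord[OF x] by (intro inj) (auto simp: hpart_Pol)
    then show ?thesis by (metis homog_hpart)
  qed
  have Sq_carrier: "Sq E i e \<in> carrier E" for i using Sq_gr[OF e(1)] gr_carrier by blast
  define w where "w i = coord (Sq E i e)" for i
  have w_P: "w i \<in> ?P" and Sq_e: "Sq E i e = w i \<odot>\<^bsub>E\<^esub> e" for i
    using coord[OF Sq_carrier] by (simp_all add: w_def)
  have w_homog: "homog i (w i)" for i
    using coord_gr[OF Sq_gr[OF e(1)], of i] by (simp add: w_def)
  have one: "1 \<odot>\<^bsub>E\<^esub> e = e" using E.smult_one[OF e'] by simp
  have w_0: "w 0 = 1"
    using U.Sq_0[of e] e' coord_smult[of 1] by (simp add: w_def underlying_simps one)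
  have w_unstable: "w i = 0" if "n < i" for i
    using U.unstable[OF _ , of e "int n" i] e that coord_smult[of 0] by (simp add: w_def underlying_simps smult_zero)
  have Sq_smult: "Sq E i (h \<odot>\<^bsub>E\<^esub> e) = (\<Sum>j\<le>i. Hstar_Sq j h * w (i - j)) \<odot>\<^bsub>E\<^esub> e" if h: "h \<in> ?P" for i h
  proof -
    have "Sq E i (h \<odot>\<^bsub>E\<^esub> e) = (\<Oplus>\<^bsub>E\<^esub> j \<in> {..i}. Hstar_Sq j h \<odot>\<^bsub>E\<^esub> Sq E (i - j) e)"
      using Cartan[of h e i] h e' by (simp add: carrier_Hstar)
    also have "\<dots> = (\<Oplus>\<^bsub>E\<^esub> j \<in> {..i}. (Hstar_Sq j h * w (i - j)) \<odot>\<^bsub>E\<^esub> e)"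
      using h w_P Hstar_Sq_Pol[OF h] e'
      by (intro E.M.finsum_cong') (auto simp: Sq_e smult_mult carrier_Hstar Pol_mult)
    also have "\<dots> = (\<Sum>j\<le>i. Hstar_Sq j h * w (i - j)) \<odot>\<^bsub>E\<^esub> e"
      using h w_P Hstar_Sq_Pol[OF h] by (intro finsum_smult_generator e') (auto simp: Pol_mult)
    finally show ?thesis .
  qed
  \<comment> \<open>The maximum exists because \<open>w 0 = 1\<close> and, by instability,
    \<open>w i = 0\<close> for \<open>i > n\<close>.\<close>
  define m where "m = (GREATEST i. w i \<noteq> 0)"
  have bounded: "\<And>i. w i \<noteq> 0 \<Longrightarrow> i \<le> n" using w_unstable not_le_imp_less by blast
  have wm: "w m \<noteq> 0" unfolding m_def by (rule GreatestI_nat[of _ 0 n]) (use bounded w_0 in auto)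
  have mn: "m \<le> n" using bounded wm by blast
  have w_m: "w i = 0" if "m < i" for i
    using Greatest_le_nat[of "\<lambda>i. w i \<noteq> 0" i n] bounded that unfolding m_def by force
  have Adem_w: "(\<Sum>j\<le>a. Hstar_Sq j (w m) * w (a - j)) = (if even a then (w (a div 2))\<^sup>2 * w m else 0)" for a
  proof -
    \<comment> \<open>The Adem relation covers \<open>0 < a < 2 * m\<close>. For
      \<open>a \<ge> 2 * m\<close> a nonzero term requires \<open>j \<le> m\<close> and
      \<open>a - j \<le> m\<close>, which leaves only \<open>j = m\<close> with
      \<open>a = 2 * m\<close>.\<close>
    consider "a = 0" | "0 < a" "a < 2 * m" | "0 < a" "2 * m \<le> a" by linarith
    then show ?thesis
    proof cases
      case 1
      then show ?thesis by (simp add: w_0 Hstar_Sq_0)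
    next
      case 3
      have "(\<Sum>j\<le>a. Hstar_Sq j (w m) * w (a - j)) =
          (\<Sum>j\<le>a. if j = m \<and> a = 2 * m then (w m)\<^sup>2 * w m else 0)"
      proof (rule sum.cong[OF refl])
        fix j assume "j \<in> {..a}"
        then consider "m < j" | "m < a - j" | "j = m" "a = 2 * m" using 3 by fastforce
        then show "Hstar_Sq j (w m) * w (a - j) = (if j = m \<and> a = 2 * m then (w m)\<^sup>2 * w m else 0)"
        proof cases
          case 3
          then show ?thesis by (simp add: Hstar_Sq_top[OF w_homog])
        qed (use Hstar_Sq_eq_0[OF w_homog, of m j] w_m in auto)
      qed
      also have "\<dots> = (if even a then (w (a div 2))\<^sup>2 * w m else 0)"
      proof (cases "a = 2 * m")
        case False
        then have "even a \<Longrightarrow> m < a div 2" using 3 by (auto elim!: evenE)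
        then show ?thesis using False w_m by auto
      qed auto
      finally show ?thesis .
    next
      case 2
      \<comment> \<open>Here \<open>s i c\<close> is the coordinate of
        \<open>Sq E i (Sq E c e)\<close>, and \<open>b c\<close> is the Adem coefficient viewed as a
        constant polynomial.\<close>
      define s where "s i c = (\<Sum>j\<le>i. Hstar_Sq j (w c) * w (i - j))" for i c
      define b where "b c = Poly_Mapping.single (0::monom) (of_nat ((m - 1 - c) choose (a - 2 * c)) :: bit)" for c
      have s_P: "s i c \<in> ?P" for i c
        unfolding s_def by (intro Pol_sum Pol_mult Hstar_Sq_Pol w_P)
      have b_P: "b c \<in> ?P" for c by (simp add: b_def Pol_def del: single_of_nat)
      have "s a m \<odot>\<^bsub>E\<^esub> e = Sq E a (Sq E m e)"
        using Sq_smult[OF w_P] by (simp add: Sq_e s_def)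
      also have "\<dots> = (\<Oplus>\<^bsub>E\<^esub> c \<in> {..a div 2}. b c \<odot>\<^bsub>E\<^esub> Sq E (a + m - c) (Sq E c e))"
        using U.Adem[of e a m] e' 2 by (simp add: underlying_simps underlying_finsum b_def)
      also have "\<dots> = (\<Oplus>\<^bsub>E\<^esub> c \<in> {..a div 2}. (b c * s (a + m - c) c) \<odot>\<^bsub>E\<^esub> e)"
        using Sq_smult[OF w_P] s_P b_P e'
        by (intro E.M.finsum_cong') (auto simp: Sq_e smult_mult carrier_Hstar Pol_mult simp flip: s_def)
      also have "\<dots> = (\<Sum>c\<le>a div 2. b c * s (a + m - c) c) \<odot>\<^bsub>E\<^esub> e"
        using s_P b_P by (intro finsum_smult_generator e') (auto simp: Pol_mult)
      finally have "s a m = (\<Sum>c\<le>a div 2. b c * s (a + m - c) c)"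
        using s_P b_P by (intro inj) (auto intro!: Pol_sum Pol_mult)
      also have "\<dots> = (\<Sum>c\<le>a div 2. if a = 2 * c then (w c)\<^sup>2 * w m else 0)"
      proof (rule sum.cong[OF refl])
        fix c assume c: "c \<in> {..a div 2}"
        \<comment> \<open>A nonzero term requires \<open>j \<le> c\<close> and
          \<open>a + m - c - j \<le> m\<close>, so \<open>j \<ge> a - c \<ge> c\<close> by
          \<open>c \<le> a div 2\<close>; this forces \<open>j = c\<close> and
          \<open>a = 2 * c\<close>.\<close>
        have "s (a + m - c) c = (\<Sum>j\<le>a + m - c. if j = c \<and> a = 2 * c then (w c)\<^sup>2 * w m else 0)"
          unfolding s_def
        proof (rule sum.cong[OF refl])
          fix j assume "j \<in> {..a + m - c}"
          then consider "c < j" | "m < a + m - c - j" | "j = c" "a = 2 * c" using 2 c by fastforce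
          then show "Hstar_Sq j (w c) * w (a + m - c - j) = (if j = c \<and> a = 2 * c then (w c)\<^sup>2 * w m else 0)"
          proof cases
            case 3
            then show ?thesis by (simp add: Hstar_Sq_top[OF w_homog])
          next
            case 2
            then show ?thesis using w_m c by auto
          qed (use Hstar_Sq_eq_0[OF w_homog, of c j] in auto)
        qed
        also have "\<dots> = (if a = 2 * c then (w c)\<^sup>2 * w m else 0)" using 2 by auto
        \<comment> \<open>For \<open>a = 2 * c\<close> the lower index of the binomial coefficient
          is zero, so \<open>b c = 1\<close>.\<close>
        finally show "b c * s (a + m - c) c = (if a = 2 * c then (w c)\<^sup>2 * w m else 0)"
          by (simp add: b_def)
      qed
      also have "\<dots> = (if even a then (w (a div 2))\<^sup>2 * w m else 0)"
      proof (cases "even a")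
        case True
        then have "(\<Sum>c\<le>a div 2. if a = 2 * c then (w c)\<^sup>2 * w m else 0) =
            (\<Sum>c\<le>a div 2. if c = a div 2 then (w (a div 2))\<^sup>2 * w m else 0)"
          by (intro sum.cong) auto
        then show ?thesis using True by simp
      qed (auto intro!: sum.neutral)
      finally show ?thesis by (simp add: s_def)
    qed
  qed
  note total = Adem_imp_total_square[OF w_homog w_0 w_m Adem_w]
  obtain ts where ts: "set ts \<subseteq> linear_forms (rank V) - {0}" "w m = prod_list ts"
    using Sq_stable_product[OF w_P w_homog wm total(1,2)] by blast
  have "homog (length ts) (prod_list ts)" if "set ts \<subseteq> linear_forms (rank V) - {0}" for ts
    using that
  proof (induction ts)
    case (Cons \<theta> ts)
    then show ?case using homog_mult[of 1 \<theta> "length ts" "prod_list ts"] by (simp add: linear_forms_def)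
  qed simp
  then have "homog (length ts) (w m)" using ts by simp
  \<comment> \<open>The nonzero \<open>w m\<close> is homogeneous of both degrees, so they
    agree.\<close>
  then have len: "length ts = m"
    using hpart_homog[OF w_homog, of "length ts" m] hpart_homog[of "length ts" "w m" "length ts"] wm
    by (auto split: if_splits)
  define u where "u = w m"
  \<comment> \<open>The generator \<open>u\<close> of the ideal has degree \<open>m\<close> and that
    of \<open>E\<close> has degree \<open>n\<close>; \<open>m \<le> n\<close> makes the subtraction
    exact.\<close>
  define d where "d = n - m"
  let ?I = "suspension d (principal_ideal_module V u)"
  have I: "carrier ?I = {h * u | h. h \<in> ?P}" "x \<oplus>\<^bsub>?I\<^esub> y = x + y" "h \<odot>\<^bsub>?I\<^esub> x = h * x"
    "gr ?I k = {h * u | h. h \<in> ?P} \<inter> Hstar_gr V (k - int d)" "Sq ?I = Hstar_Sq" for x y h k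
    by (simp_all add: suspension_def principal_ideal_module_def cgenideal_def carrier_Hstar)
  define \<phi> where "\<phi> x = coord x * u" for x
  have \<phi>: "\<phi> (h \<odot>\<^bsub>E\<^esub> e) = h * u" if "h \<in> ?P" for h using coord_smult[OF that] by (simp add: \<phi>_def)
  have "sq_iso (Hstar V) E ?I"
    unfolding sq_iso_def
  proof (intro exI[of _ \<phi>] conjI ballI allI)
    show "bij_betw \<phi> (carrier E) (carrier ?I)"
      unfolding bij_betw_def
    proof
      show "inj_on \<phi> (carrier E)"
        using coord wm by (intro inj_onI) (metis \<phi>_def mult_right_cancel u_def)
      have "h * u \<in> \<phi> ` carrier E" if "h \<in> ?P" for h
        using \<phi>[OF that] that e' by (intro image_eqI[of _ _ "h \<odot>\<^bsub>E\<^esub> e"]) (auto simp: carrier_Hstar)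
      then show "\<phi> ` carrier E = carrier ?I" using coord unfolding I by (auto simp: \<phi>_def)
    qed
  next
    fix x y assume "x \<in> carrier E" "y \<in> carrier E"
    then obtain h g where hg: "h \<in> ?P" "x = h \<odot>\<^bsub>E\<^esub> e" "g \<in> ?P" "y = g \<odot>\<^bsub>E\<^esub> e" using gen by metis
    then show "\<phi> (x \<oplus>\<^bsub>E\<^esub> y) = \<phi> x \<oplus>\<^bsub>?I\<^esub> \<phi> y"
      using \<phi>[OF Pol_add[OF hg(1,3)]] by (simp add: \<phi> I smult_add distrib_right)
  next
    fix c x assume "c \<in> carrier (Hstar V)" "x \<in> carrier E"
    then obtain h where h: "h \<in> ?P" "x = h \<odot>\<^bsub>E\<^esub> e" "c \<in> ?P" using gen carrier_Hstar by metis
    then show "\<phi> (c \<odot>\<^bsub>E\<^esub> x) = c \<odot>\<^bsub>?I\<^esub> \<phi> x"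
      using \<phi>[OF Pol_mult[OF h(3,1)]] by (simp add: \<phi> I smult_mult mult_ac)
  next
    fix k x assume x: "x \<in> gr E k"
    have "coord x * u \<in> Hstar_gr V (k - int d)"
    proof (cases "int n \<le> k")
      case True
      then have "homog (nat (k - int n) + m) (coord x * u)"
        using homog_mult[OF _ w_homog] coord_gr[OF x] by (simp add: u_def)
      moreover have "k - int d = int (nat (k - int n) + m)" using True mn by (simp add: d_def)
      moreover have "coord x * u \<in> ?P" using coord[OF gr_carrier[OF x]] w_P by (simp add: u_def Pol_mult)
      ultimately show ?thesis by (simp only: Hstar_gr_nat mem_Collect_eq)
    next
      case False
      then show ?thesis using coord_gr[OF x] by (simp add: Hstar_gr_def carrier_Hstar)
    qed
    then show "\<phi> x \<in> gr ?I k" using coord[OF gr_carrier[OF x]] unfolding I \<phi>_def by blast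
  next
    fix i x assume "x \<in> carrier E"
    then obtain h where h: "h \<in> ?P" "x = h \<odot>\<^bsub>E\<^esub> e" using gen by metis
    have "\<phi> (Sq E i x) = (\<Sum>j\<le>i. Hstar_Sq j h * w (i - j)) * u"
      unfolding h(2) Sq_smult[OF h(1)]
      by (intro \<phi> Pol_sum Pol_mult Hstar_Sq_Pol w_P h)
    \<comment> \<open>The Cartan formula for \<open>h * u\<close>, where
      \<open>Hstar_Sq (i - j) u = w (i - j) * u\<close>: the squares of \<open>u\<close> and of
      \<open>e\<close> have the same coefficients.\<close>
    also have "\<dots> = Hstar_Sq i (h * u)"
      by (simp add: Hstar_Sq_mult total(3) u_def sum_distrib_right mult.assoc)
    finally show "\<phi> (Sq E i x) = Sq ?I i (\<phi> x)" by (simp add: I h \<phi>)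
  qed
  then show ?thesis using ts len mn by (intro exI[of _ d] exI[of _ ts]) (simp add: d_def u_def)
qed

end

theorem theorem1p2:
  fixes V :: "('g, 'm) monoid_scheme" and n :: nat and E :: "(poly2, 'e) sq_module"
  assumes "elementary_abelian_2_group V"
    and "unstable_HV_A_module V E"
    and "free_module (Hstar V) E"
    and "sq_iso F2 (reduction V E) (suspension n F2_module)"
  shows "\<exists>u\<in>carrier (Hstar V). \<exists>(d::nat) (s::nat) (\<theta> :: nat \<Rightarrow> poly2) (\<alpha> :: nat \<Rightarrow> nat).
           (\<forall>i<s. \<theta> i \<in> Hstar_gr V 1 - {0}) \<and>
           u = (\<Prod>i<s. \<theta> i ^ \<alpha> i) \<and>
           sq_iso (Hstar V) E (suspension d (principal_ideal_module V u)) \<and>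
           d + (\<Sum>i<s. \<alpha> i) = n"
proof -
  interpret unstable_HV_A_module V E by (rule assms(2))
  obtain e where e: "e \<in> gr E (int n)" "e \<noteq> \<zero>\<^bsub>E\<^esub>"
    "\<And>x. x \<in> carrier E \<Longrightarrow> x \<in> decomposables \<or> (\<exists>z\<in>decomposables. x = z \<oplus>\<^bsub>E\<^esub> e)"
    using reduction_generator[OF assms(4)] by blast
  obtain d ts where ts: "set ts \<subseteq> linear_forms (rank V) - {0}" "d + length ts = n"
      "sq_iso (Hstar V) E (suspension d (principal_ideal_module V (prod_list ts)))"
    using product_of_linear_forms[OF assms(3) e(1,2) graded_Nakayama[OF e(1,3)]] by blast
  \<comment> \<open>Repeated factors stay separate in the list, so every exponent can be taken as
    1.\<close>
  have prod: "prod_list ts = (\<Prod>i<length ts. (ts ! i) ^ 1)"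
    by (simp add: prod.list_conv_set_nth lessThan_atLeast0)
  have linear_forms: "ts ! i \<in> Hstar_gr V 1 - {0}" if "i < length ts" for i
    using ts(1) nth_mem[OF that] linear_forms_eq by blast
  have "prod_list ts \<in> carrier (Hstar V)"
    unfolding prod carrier_Hstar using linear_forms
    by (intro Pol_prod Pol_power) (auto simp: Hstar_gr_def carrier_Hstar)
  then show ?thesis
    using ts(2,3) prod linear_forms
    by (intro bexI[of _ "prod_list ts"] exI[of _ d] exI[of _ "length ts"] exI[of _ "(!) ts"]
        exI[of _ "\<lambda>_. 1"]) auto
qed

end
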